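(* Let $\theta$ be a large enough regular cardinal, $(X,\tau)\in H(\theta)$ a countably tight topological space, and $\mathbb{P}\in H(\theta)$ a poset. Suppose that the set of countable $M\prec H(\theta)$ such that $\mathbb{P}$ is strongly proper for $M$ is stationary in $[H(\theta)]^{\aleph_0}$. Then $\mathbb{P}$ forces that $(X,\tau)$ is countably tight.
   Context: $H(\theta)$ is the collection of sets hereditarily of cardinality $<\theta$; "large enough" has its usual meaning ($\theta\ge\omega_2$ and $H(\theta)$ contains all relevant objects, such as power sets, topologies, and names built from $\mathbb{P}$ and $X$). Strong properness. Let $M\prec H(\theta)$ be countable with $\mathbb{P}\in M$. For $q\in\mathbb{P}$, a condition $\bar q\in M\cap\mathbb{P}$ is a residue of $q$ to $M$ if every $s\le\bar q$ with $s\in M$ is compatible with $q$. A condition $p\in\mathbb{P}$ is $(M,\mathbb{P})$-strongly generic if every $q\le p$ has a residue to $M$. $\mathbb{P}$ is strongly proper for $M$ if every $s\in M\cap\mathbb{P}$ can be extended to an $(M,\mathbb{P})$-strongly generic condition. Preservation. If $G$ is $V$-generic over $\mathbb{P}$, then $\tau^G$ denotes the topology on $X$ in $V[G]$ having $\tau$ as a basis. "$\mathbb{P}$ forces that $(X,\tau)$ has property $\Phi$" means that every condition forces that $(X,\tau^{\dot G})$ has property $\Phi$. A space $X$ is countably tight if for every $x\in X$ and every $A\subseteq X$ with $x\in\mathrm{cl}(A)$ there is a countable $B\subseteq A$ with $x\in\mathrm{cl}(B)$. *)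

theory Defs
  imports "HOL-Analysis.Abstract_Topology"
begin

unbundle cardinal_syntax

section \<open>The set-theoretic universe\<close>

text \<open>
  The universe \<open>V\<close> is a type variable of the following class; its elements are the sets, and
  \<open>elts x\<close> is the extension of \<open>x\<close>. The axioms are those of ZFC with replacement for arbitrary
  functions of the logic, so that separation follows from replacement, and choice from
  replacement together with Hilbert choice. A consequence used throughout: a collection
  \<open>S :: 'v set\<close> included in some \<open>elts x\<close>, or in bijection with one, is the extension of a set.
  In particular \<open>\<omega>\<close> of \<open>V\<close> is standard and \<open>countable\<close>, \<open>|A| <o |B|\<close> etc. have the same
  meaning inside \<open>V\<close> and in the logic.
\<close>

class zfc =
  fixes elts :: "'a \<Rightarrow> 'a set"
  assumes extensionality: "elts x = elts y \<Longrightarrow> x = y"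
    and foundation: "wf {(y, x). y \<in> elts x}"
    and pairing: "\<exists>z. elts z = {x, y}"
    and union: "\<exists>u. elts u = \<Union> (elts ` elts x)"
    and powerset: "\<exists>u. elts u = {y. elts y \<subseteq> elts x}"
    and infinity: "\<exists>w. (\<exists>e\<in>elts w. elts e = {}) \<and>
                      (\<forall>n\<in>elts w. \<exists>s\<in>elts w. elts s = insert n (elts n))"
    and replacement: "\<exists>u. elts u = f ` elts x"

text \<open>The set with extension \<open>S\<close>; meaningful if there is one, i.e. if \<open>S\<close> is not a proper class.\<close>

definition vset :: "'v::zfc set \<Rightarrow> 'v" where
  "vset S = (THE x. elts x = S)"

definition opair :: "'v::zfc \<Rightarrow> 'v \<Rightarrow> 'v" where
  "opair a b = vset {vset {a}, vset {a, b}}"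

definition vpow :: "'v::zfc \<Rightarrow> 'v" where
  "vpow x = vset {y. elts y \<subseteq> elts x}"

lemma elts_vset: "elts x = S \<Longrightarrow> elts (vset S) = S"
  unfolding vset_def by (rule theI2[of _ x]) (auto intro: extensionality)

lemma elts_vset_pair [simp]: "elts (vset {a, b}) = {a, b}" for a :: "'v::zfc"
proof -
  obtain z where "elts z = {a, b}" using pairing by blast
  then show ?thesis by (rule elts_vset)
qed

lemma elts_vset_singleton [simp]: "elts (vset {a}) = {a}" for a :: "'v::zfc"
  using elts_vset_pair[of a a] by simp

lemma opair_eq_iff [simp]: "opair a b = opair c d \<longleftrightarrow> a = c \<and> b = d" for a :: "'v::zfc"
proof
  assume "opair a b = opair c d"
  then have "elts ` elts (opair a b) = elts ` elts (opair c d)" by (rule arg_cong)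
  then have "{{a}, {a, b}} = {{c}, {c, d}}" by (simp add: opair_def)
  then show "a = c \<and> b = d"
    by (auto simp: doubleton_eq_iff)
qed simp

section \<open>Cardinals and \<open>H(\<theta>)\<close>\<close>

definition is_ordinal :: "'v::zfc \<Rightarrow> bool" where
  "is_ordinal \<alpha> \<longleftrightarrow> (\<forall>x\<in>elts \<alpha>. elts x \<subseteq> elts \<alpha>) \<and> (\<forall>x\<in>elts \<alpha>. \<forall>y\<in>elts x. elts y \<subseteq> elts x)"

definition is_cardinal :: "'v::zfc \<Rightarrow> bool" where
  "is_cardinal \<kappa> \<longleftrightarrow> is_ordinal \<kappa> \<and> (\<forall>\<alpha>\<in>elts \<kappa>. |elts \<alpha>| <o |elts \<kappa>| )"

definition regular_cardinal :: "'v::zfc \<Rightarrow> bool" where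
  "regular_cardinal \<kappa> \<longleftrightarrow> is_cardinal \<kappa> \<and> infinite (elts \<kappa>) \<and> regularCard |elts \<kappa>|"

definition trcl :: "'v::zfc \<Rightarrow> 'v set" where
  "trcl x = {y. (y, x) \<in> {(z, w). z \<in> elts w}\<^sup>+}"

definition Hset :: "'v::zfc \<Rightarrow> 'v set" where
  "Hset \<theta> = {x. |trcl x| <o |elts \<theta>| }"

section \<open>Formulas of set theory, satisfaction, elementary submodels\<close>

text \<open>De Bruijn indices: a quantifier binds index \<open>0\<close> and shifts the free indices by one.\<close>

datatype fm = Mem nat nat | Eq nat nat | Negate fm | And fm fm | Forall fm

primrec sat :: "'v::zfc set \<Rightarrow> fm \<Rightarrow> (nat \<Rightarrow> 'v) \<Rightarrow> bool" where
  "sat D (Mem i j) \<rho> \<longleftrightarrow> \<rho> i \<in> elts (\<rho> j)"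
| "sat D (Eq i j) \<rho> \<longleftrightarrow> \<rho> i = \<rho> j"
| "sat D (Negate \<phi>) \<rho> \<longleftrightarrow> \<not> sat D \<phi> \<rho>"
| "sat D (And \<phi> \<psi>) \<rho> \<longleftrightarrow> sat D \<phi> \<rho> \<and> sat D \<psi> \<rho>"
| "sat D (Forall \<phi>) \<rho> \<longleftrightarrow> (\<forall>a\<in>D. sat D \<phi> (case_nat a \<rho>))"

definition elementary_submodel :: "'v::zfc set \<Rightarrow> 'v set \<Rightarrow> bool" where
  "elementary_submodel M D \<longleftrightarrow> M \<noteq> {} \<and> M \<subseteq> D \<and>
     (\<forall>\<phi> \<rho>. range \<rho> \<subseteq> M \<longrightarrow> (sat M \<phi> \<rho> \<longleftrightarrow> sat D \<phi> \<rho>))"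

section \<open>Stationarity in \<open>[A]\<^sup>\<aleph>\<^sup>0\<close>\<close>

definition ctbl_subsets :: "'a set \<Rightarrow> 'a set set" where
  "ctbl_subsets A = {x. x \<subseteq> A \<and> countable x \<and> infinite x}"

definition club :: "'a set \<Rightarrow> 'a set set \<Rightarrow> bool" where
  "club A C \<longleftrightarrow> C \<subseteq> ctbl_subsets A \<and>
     (\<forall>x\<in>ctbl_subsets A. \<exists>y\<in>C. x \<subseteq> y) \<and>
     (\<forall>x :: nat \<Rightarrow> 'a set. range x \<subseteq> C \<and> incseq x \<longrightarrow> (\<Union>n. x n) \<in> C)"

definition stationary :: "'a set \<Rightarrow> 'a set set \<Rightarrow> bool" where
  "stationary A S \<longleftrightarrow> (\<forall>C. club A C \<longrightarrow> S \<inter> C \<noteq> {})"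

section \<open>Posets and strong properness\<close>

text \<open>A poset is an element \<open>\<langle>Q, L\<rangle>\<close> of the universe, where \<open>L\<close> is the set of pairs \<open>\<langle>p, q\<rangle>\<close> with
  \<open>p \<le> q\<close>. A largest element is not required.\<close>

definition conds :: "'v::zfc \<Rightarrow> 'v set" where
  "conds P = {p. \<exists>Q L. P = opair Q L \<and> p \<in> elts Q}"

definition le :: "'v::zfc \<Rightarrow> 'v \<Rightarrow> 'v \<Rightarrow> bool" where
  "le P p q \<longleftrightarrow> (\<exists>Q L. P = opair Q L \<and> opair p q \<in> elts L)"

definition is_poset :: "'v::zfc \<Rightarrow> bool" where
  "is_poset P \<longleftrightarrow> (\<exists>Q L. P = opair Q L \<and> (\<forall>z\<in>elts L. \<exists>p q. z = opair p q)) \<and>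
     partial_order_on (conds P) {(p, q). le P p q}"

definition compatible :: "'v::zfc \<Rightarrow> 'v \<Rightarrow> 'v \<Rightarrow> bool" where
  "compatible P p q \<longleftrightarrow> (\<exists>r\<in>conds P. le P r p \<and> le P r q)"

definition is_residue :: "'v::zfc \<Rightarrow> 'v set \<Rightarrow> 'v \<Rightarrow> 'v \<Rightarrow> bool" where
  "is_residue P M q r \<longleftrightarrow> r \<in> M \<inter> conds P \<and>
     (\<forall>s\<in>M \<inter> conds P. le P s r \<longrightarrow> compatible P s q)"

definition strongly_generic :: "'v::zfc \<Rightarrow> 'v set \<Rightarrow> 'v \<Rightarrow> bool" where
  "strongly_generic P M p \<longleftrightarrow> p \<in> conds P \<and>
     (\<forall>q\<in>conds P. le P q p \<longrightarrow> (\<exists>r. is_residue P M q r))"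

definition strongly_proper_for :: "'v::zfc \<Rightarrow> 'v set \<Rightarrow> bool" where
  "strongly_proper_for P M \<longleftrightarrow>
     (\<forall>s\<in>M \<inter> conds P. \<exists>p. le P p s \<and> strongly_generic P M p)"

section \<open>Names and the forcing relation\<close>

inductive is_name :: "'v::zfc \<Rightarrow> 'v \<Rightarrow> bool" for P where
  "(\<And>z. z \<in> elts a \<Longrightarrow> \<exists>c p. z = opair c p \<and> p \<in> conds P \<and> is_name P c) \<Longrightarrow> is_name P a"

text \<open>There being no largest condition, every condition is attached to every element of a
  check name.\<close>

function check :: "'v::zfc \<Rightarrow> 'v \<Rightarrow> 'v" where
  "check P x = vset ((\<lambda>(c, p). opair c p) ` ((\<lambda>y. check P y) ` elts x \<times> conds P))"
  by auto
termination
  by (relation "inv_image {(y, x). y \<in> elts x} snd") (auto intro: wf_inv_image foundation)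

declare check.simps [simp del]

text \<open>The usual recursion for atomic formulas: \<open>p\<close> forces \<open>a \<in> b\<close> if densely many \<open>r\<close> below \<open>p\<close> force
  \<open>a = c\<close> for some \<open>\<langle>c, s\<rangle> \<in> b\<close> with \<open>r \<le> s\<close>; equality is mutual inclusion. The recursive calls occur positively and descend
  to names of smaller rank, so the inductive definition yields the unique solution of the
  recursion.\<close>

inductive forces_eq :: "'v::zfc \<Rightarrow> 'v \<Rightarrow> 'v \<Rightarrow> 'v \<Rightarrow> bool"
  and forces_mem :: "'v::zfc \<Rightarrow> 'v \<Rightarrow> 'v \<Rightarrow> 'v \<Rightarrow> bool" for P where
  eqI: "\<lbrakk>p \<in> conds P;
     \<And>c s q. \<lbrakk>opair c s \<in> elts a; q \<in> conds P; le P q p; le P q s\<rbrakk> \<Longrightarrow> forces_mem P q c b;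
     \<And>c s q. \<lbrakk>opair c s \<in> elts b; q \<in> conds P; le P q p; le P q s\<rbrakk> \<Longrightarrow> forces_mem P q c a\<rbrakk>
   \<Longrightarrow> forces_eq P p a b"
| memI: "\<lbrakk>p \<in> conds P;
     \<And>q. \<lbrakk>q \<in> conds P; le P q p\<rbrakk> \<Longrightarrow>
       \<exists>r\<in>conds P. le P r q \<and> (\<exists>c s. opair c s \<in> elts b \<and> le P r s \<and> forces_eq P r a c)\<rbrakk>
   \<Longrightarrow> forces_mem P p a b"

primrec forces :: "'v::zfc \<Rightarrow> 'v \<Rightarrow> fm \<Rightarrow> (nat \<Rightarrow> 'v) \<Rightarrow> bool" where
  "forces P p (Mem i j) \<rho> \<longleftrightarrow> forces_mem P p (\<rho> i) (\<rho> j)"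
| "forces P p (Eq i j) \<rho> \<longleftrightarrow> forces_eq P p (\<rho> i) (\<rho> j)"
| "forces P p (Negate \<phi>) \<rho> \<longleftrightarrow> (\<forall>q\<in>conds P. le P q p \<longrightarrow> \<not> forces P q \<phi> \<rho>)"
| "forces P p (And \<phi> \<psi>) \<rho> \<longleftrightarrow> forces P p \<phi> \<rho> \<and> forces P p \<psi> \<rho>"
| "forces P p (Forall \<phi>) \<rho> \<longleftrightarrow> (\<forall>a. is_name P a \<longrightarrow> forces P p \<phi> (case_nat a \<rho>))"

section \<open>Countable tightness\<close>

definition countably_tight :: "'a topology \<Rightarrow> bool" where
  "countably_tight T \<longleftrightarrow> (\<forall>x\<in>topspace T. \<forall>A\<subseteq>topspace T. x \<in> T closure_of A \<longrightarrow>
     (\<exists>B\<subseteq>A. countable B \<and> x \<in> T closure_of B))"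

text \<open>\<open>\<langle>X, \<tau>\<rangle>\<close> is a topological space, all of whose data are sets of the universe.\<close>

definition is_topological_space :: "'v::zfc \<Rightarrow> 'v \<Rightarrow> bool" where
  "is_topological_space X \<tau> \<longleftrightarrow> istopology (\<lambda>U. U \<in> elts ` elts \<tau>) \<and>
     \<Union> (elts ` elts \<tau>) = elts X"

definition topology_of :: "'v::zfc \<Rightarrow> 'v topology" where
  "topology_of \<tau> = topology (\<lambda>U. U \<in> elts ` elts \<tau>)"

text \<open>In the extension \<open>\<tau>\<close> is only a basis, so countable tightness has to be expressed as a property
  of a set \<open>X\<close> and a basis \<open>T\<close>, in the language of set theory. Arguments below are
  indices of variables.\<close>

definition "Or \<phi> \<psi> = Negate (And (Negate \<phi>) (Negate \<psi>))"
definition "Imp \<phi> \<psi> = Negate (And \<phi> (Negate \<psi>))"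
definition "Iff \<phi> \<psi> = And (Imp \<phi> \<psi>) (Imp \<psi> \<phi>)"
definition "Exists \<phi> = Negate (Forall (Negate \<phi>))"
definition "BForall i \<phi> = Forall (Imp (Mem 0 (i+1)) \<phi>)"
definition "BExists i \<phi> = Exists (And (Mem 0 (i+1)) \<phi>)"

definition "subset_fm a b = BForall a (Mem 0 (b+1))"
definition "pair_fm a b z = Forall (Iff (Mem 0 (z+1)) (Or (Eq 0 (a+1)) (Eq 0 (b+1))))"
definition "opair_fm a b z =
  Exists (Exists (And (pair_fm (a+2) (a+2) 1) (And (pair_fm (a+2) (b+2) 0) (pair_fm 1 0 (z+2)))))"

definition "empty_fm z = Forall (Negate (Mem 0 (z+1)))"
definition "succ_fm n s = Forall (Iff (Mem 0 (s+1)) (Or (Mem 0 (n+1)) (Eq 0 (n+1))))"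
definition "inductive_fm w = And (BExists w (empty_fm 0)) (BForall w (BExists (w+1) (succ_fm 1 0)))"
definition "omega_fm w = And (inductive_fm w) (Forall (Imp (inductive_fm 0) (subset_fm (w+1) 0)))"

text \<open>\<open>f\<close> is an injective function from \<open>B\<close> to \<open>C\<close>.\<close>

definition "app_fm f a b = BExists f (opair_fm (a+1) (b+1) 0)"
definition "injection_fm f B C =
  And (BForall f (BExists (B+1) (BExists (C+2) (opair_fm 1 0 2))))
 (And (BForall B (BExists (C+1) (app_fm (f+2) 1 0)))
 (And (BForall B (BForall (C+1) (BForall (C+2)
        (Imp (And (app_fm (f+3) 2 1) (app_fm (f+3) 2 0)) (Eq 1 0)))))
      (BForall B (BForall (B+1) (BForall (C+2)
        (Imp (And (app_fm (f+3) 2 0) (app_fm (f+3) 1 0)) (Eq 2 1)))))))"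

definition "countable_fm B = Exists (Exists (And (omega_fm 0) (injection_fm 1 (B+2) 0)))"

text \<open>\<open>W\<close> is open, and \<open>x\<close> is in the closure of \<open>A\<close>, in the topology on \<open>X\<close> with basis \<open>T\<close>.\<close>

definition "open_fm X T W =
  And (subset_fm W X) (BForall W (BExists (T+1) (And (Mem 1 0) (subset_fm 0 (W+2)))))"
definition "closure_fm X T A x =
  And (Mem x X) (Forall (Imp (And (Mem (x+1) 0) (open_fm (X+1) (T+1) 0)) (BExists (A+1) (Mem 0 1))))"

definition "countably_tight_fm X T =
  BForall X (Forall (Imp (And (subset_fm 0 (X+2)) (closure_fm (X+2) (T+2) 0 1))
    (Exists (And (subset_fm 0 1) (And (countable_fm 0) (closure_fm (X+3) (T+3) 0 2))))))"

definition forces_countably_tight :: "'v::zfc \<Rightarrow> 'v \<Rightarrow> 'v \<Rightarrow> bool" where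
  "forces_countably_tight P X \<tau> \<longleftrightarrow>
     (\<forall>p\<in>conds P. forces P p (countably_tight_fm 0 1)
        (case_nat (check P X) (\<lambda>_. check P \<tau>)))"

section \<open>Large enough \<open>\<theta>\<close>\<close>

text \<open>\<open>\<theta> \<ge> \<omega>\<^sub>2\<close>, and \<open>H(\<theta>)\<close> contains the power sets of \<open>X\<close>, \<open>\<tau>\<close>, and of the set of conditions, the
  set \<open>\<P>(\<P>(X))\<close> containing all topologies on \<open>X\<close>, and the set of all names for subsets of \<open>X\<close>
  built from check names of points of \<open>X\<close> and conditions.\<close>

definition large_enough :: "'v::zfc \<Rightarrow> 'v \<Rightarrow> 'v \<Rightarrow> 'v \<Rightarrow> bool" where
  "large_enough \<theta> P X \<tau> \<longleftrightarrow>
     cardSuc (cardSuc natLeq) \<le>o |elts \<theta>| \<and>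
     {vpow X, vpow (vpow X), vpow \<tau>, vpow (vset (conds P)),
      vpow (vset {opair (check P y) p | y p. y \<in> elts X \<and> p \<in> conds P})} \<subseteq> Hset \<theta>"

end

(* For a name A and a condition q forcing x to be in the closure of A, the set Z_r of all y that
   some s \<le> r forces into A has x in its closure, for every r \<le> q; countable tightness in V gives a
   countable B_r \<subseteq> Z_r with x in its closure. Let M be countable with q \<in> M, closed under r \<mapsto> B_r, under a
   choice of witnesses s for y \<in> Z_r, and under a choice of common extensions with q. Such M form a
   club, so some M of this kind has a strongly generic p \<le> q. Then p forces x into the closure of
   A \<inter> M: if t \<le> p and U is a basic neighbourhood of x, a residue r \<in> M of t, which may be taken
   below q, has a y \<in> B_r \<inter> U; y and its witness s \<le> r are in M, so s is compatible with t.
   Of the elementarity of M only these closure properties are needed. *)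

theory Submission
  imports Defs
begin

section \<open>Small collections\<close>

text \<open>The residue to be used is known only after M and p are fixed, so a single countable set
  prepared for the initial condition would not do: every r below q gets its own B_r, and M includes
  B_r whenever it contains r. A residue r of t may be taken below q because r extends itself: it is
  compatible with t, hence with q, and a common extension of r and q in M inherits the residue
  property, since everything below it is below r. There is no generic filter here; forcing is a
  recursion on formulas over names. Countability of A \<inter> M and the closure statement are
  therefore verified formula by formula, with an explicit name for an injection into omega. Two
  facts keep this manageable: equality and membership of check names are decided by truth in V, and
  a bounded quantifier over a name ranges only over the names in its domain. The closure formula
  then becomes a statement about conditions and sets of V, to which the combinatorial argument
  applies.\<close>

definition small :: "'v::zfc set \<Rightarrow> bool" where
  "small S \<longleftrightarrow> (\<exists>x. elts x = S)"

lemma small_elts [simp]: "small (elts x)"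
  by (auto simp: small_def)

lemma elts_vset_small: "small S \<Longrightarrow> elts (vset S) = S"
  by (auto simp: small_def elts_vset)

lemma small_image: "small S \<Longrightarrow> small (f ` S)" for f :: "'v::zfc \<Rightarrow> 'v"
  unfolding small_def using replacement[of f] by metis

lemma small_empty [simp]: "small ({} :: 'v::zfc set)"
  unfolding small_def using infinity by metis

text \<open>Separation from replacement: points of \<open>S\<close> outside \<open>T\<close> are
  sent to a fixed \<open>t\<close> in \<open>T\<close>, which makes \<open>T\<close> an image of
  \<open>S\<close>. The empty set comes from \<open>infinity\<close>.\<close>

lemma small_subset:
  assumes "small S" "T \<subseteq> S"
  shows "small T"
proof (cases "T = {}")
  case False
  then obtain t where "t \<in> T" by blast
  then have "T = (\<lambda>x. if x \<in> T then x else t) ` S"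
    using assms(2) by auto
  then show ?thesis
    using small_image[OF assms(1)] by metis
qed simp

lemma small_UN:
  fixes A :: "'v::zfc set" and f :: "'v \<Rightarrow> 'v set"
  assumes "small A" "\<And>x. x \<in> A \<Longrightarrow> small (f x)"
  shows "small (\<Union>x\<in>A. f x)"
proof -
  obtain a where a: "elts a = A"
    using assms(1) by (auto simp: small_def)
  obtain u where u: "elts u = (\<lambda>x. vset (f x)) ` elts a"
    using replacement[of "\<lambda>x. vset (f x)" a] by blast
  obtain w where "elts w = \<Union> (elts ` elts u)"
    using union[of u] by blast
  then have "elts w = (\<Union>x\<in>A. f x)"
    using assms(2) by (simp add: u a elts_vset_small)
  then show ?thesis
    by (auto simp: small_def)
qed

lemma small_insert: "small S \<Longrightarrow> small (insert a S)"
proof -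
  assume "small S"
  then have "small (\<Union>x\<in>elts (vset {vset {a}, vset S}). elts x)"
    by (intro small_UN) (simp_all del: elts_vset_pair)
  then show ?thesis
    using \<open>small S\<close> by (simp add: elts_vset_small)
qed

text \<open>Stated for an image because \<open>A \<times> B\<close> consists of pairs of the logic,
  which are not elements of the universe; the typical \<open>f\<close> is
  \<open>opair\<close>.\<close>

lemma small_Times_image:
  fixes A B :: "'v::zfc set" and f :: "'v \<Rightarrow> 'v \<Rightarrow> 'v"
  assumes "small A" "small B"
  shows "small ((\<lambda>(x, y). f x y) ` (A \<times> B))"
proof -
  have "(\<lambda>(x, y). f x y) ` (A \<times> B) = (\<Union>x\<in>A. f x ` B)"
    by auto
  then show ?thesis
    by (simp only:) (intro small_UN small_image assms)
qed

lemma small_conds [simp]: "small (conds P)"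
proof (cases "\<exists>Q L. P = opair Q L")
  case True
  then obtain Q L where "P = opair Q L" by blast
  then have "conds P = elts Q"
    by (auto simp: conds_def)
  then show ?thesis by simp
qed (simp add: conds_def)

section \<open>Von Neumann numerals and omega\<close>

primrec vnat :: "nat \<Rightarrow> 'v::zfc" where
  "vnat 0 = vset {}"
| "vnat (Suc n) = vset (insert (vnat n) (elts (vnat n)))"

lemma elts_vnat_0 [simp]: "elts (vnat 0) = {}"
  by (simp add: elts_vset_small)

lemma elts_vnat_Suc [simp]: "elts (vnat (Suc n)) = insert (vnat n) (elts (vnat n))"
  by (simp add: elts_vset_small small_insert)

declare vnat.simps [simp del]

lemma elts_nonrefl: "x \<notin> elts x"
  using wf_not_refl[OF foundation, of x] by simp

lemma vnat_less: "m < n \<Longrightarrow> vnat m \<in> elts (vnat n)"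
  by (induction n) (auto simp: less_Suc_eq)

lemma vnat_eq_iff [simp]: "vnat m = vnat n \<longleftrightarrow> m = n"
  by (metis elts_nonrefl linorder_neqE_nat vnat_less)

text \<open>Every set provided by \<open>infinity\<close> contains all numerals, by induction in the
  logic and extensionality; separation does the rest.\<close>

lemma small_vnats: "small (range (vnat :: nat \<Rightarrow> 'v::zfc))"
proof -
  obtain w :: 'v where w: "\<exists>e\<in>elts w. elts e = {}"
      "\<forall>n\<in>elts w. \<exists>s\<in>elts w. elts s = insert n (elts n)"
    using infinity by blast
  have "vnat n \<in> elts w" for n
  proof (induction n)
    case 0
    obtain e where e: "e \<in> elts w" "elts e = {}"
      using w(1) by blast
    then have "e = vnat 0"
      by (intro extensionality) simp
    then show ?case
      using e(1) by simp
  next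
    case (Suc n)
    then obtain s where s: "s \<in> elts w" "elts s = insert (vnat n) (elts (vnat n))"
      using w(2) by blast
    then have "s = vnat (Suc n)"
      by (intro extensionality) simp
    then show ?case
      using s(1) by simp
  qed
  then show ?thesis
    using small_subset[of "elts w" "range vnat"] by auto
qed

definition vomega :: "'v::zfc" where
  "vomega = vset (range vnat)"

lemma elts_vomega [simp]: "elts vomega = range vnat"
  by (simp add: vomega_def elts_vset_small small_vnats)

section \<open>The forcing relation\<close>

text \<open>Since c \<in> {c} \<in> \<open>opair c s\<close> \<in> a, the step from \<open>a\<close>
  to \<open>c\<close> descends three memberships, hence the transitive closure. No restriction to
  names is made, so reflexivity and transitivity of forced equality hold for arbitrary sets.\<close>

lemma dom_induct [case_names step]:
  fixes a :: "'v::zfc"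
  assumes step: "\<And>a. (\<And>c s. opair c s \<in> elts a \<Longrightarrow> Q c) \<Longrightarrow> Q a"
  shows "Q a"
proof -
  have "wf ({(y, x). y \<in> elts x}\<^sup>+ :: ('v \<times> 'v) set)"
    by (rule wf_trancl[OF foundation])
  then show ?thesis
  proof (induction a)
    case (less a)
    show ?case
    proof (rule step)
      fix c s assume "opair c s \<in> elts a"
      then have "(c, vset {c}) \<in> {(y, x). y \<in> elts x}"
          "(vset {c}, opair c s) \<in> {(y, x). y \<in> elts x}"
          "(opair c s, a) \<in> {(y, x). y \<in> elts x}"
        by (auto simp: opair_def)
      then have "(c, a) \<in> {(y, x). y \<in> elts x}\<^sup>+"
        by (rule trancl.trancl_into_trancl[OF trancl.trancl_into_trancl[OF trancl.r_into_trancl]])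
      then show "Q c" by (rule less)
    qed
  qed
qed

lemma is_name_iff:
  "is_name P a \<longleftrightarrow> (\<forall>z\<in>elts a. \<exists>c p. z = opair c p \<and> p \<in> conds P \<and> is_name P c)"
  by (subst is_name.simps) auto

lemma is_nameD: "is_name P a \<Longrightarrow> opair c s \<in> elts a \<Longrightarrow> s \<in> conds P \<and> is_name P c"
  by (subst (asm) is_name_iff) auto

lemma elts_check:
  "elts (check P x) = (\<lambda>(c, p). opair c p) ` ((\<lambda>y. check P y) ` elts x \<times> conds P)"
  by (subst check.simps) (intro elts_vset_small small_Times_image small_image small_elts small_conds)

lemma opair_in_check:
  "opair c s \<in> elts (check P x) \<longleftrightarrow> s \<in> conds P \<and> (\<exists>y\<in>elts x. c = check P y)"
  by (auto simp: elts_check)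

lemma is_name_check [simp]: "is_name P (check P x)"
proof (induction x rule: wf_induct_rule[OF foundation])
  case (1 x)
  then show ?case
    by (subst is_name_iff) (auto simp: elts_check)
qed

section \<open>Atomic forcing: monotonicity, density and the laws of equality\<close>

locale forcing_poset =
  fixes P :: "'v::zfc"
  assumes poset: "is_poset P"
begin

lemma le_conds: "le P q p \<Longrightarrow> q \<in> conds P \<and> p \<in> conds P"
  using poset
  by (auto simp: is_poset_def partial_order_on_def preorder_on_def)

lemma le_refl: "p \<in> conds P \<Longrightarrow> le P p p"
  using poset
  by (auto simp: is_poset_def partial_order_on_def preorder_on_def refl_on_def)

lemma le_trans: "le P r q \<Longrightarrow> le P q p \<Longrightarrow> le P r p"
  using poset
  by (auto simp: is_poset_def partial_order_on_def preorder_on_def trans_def) 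

lemma forces_eq_iff:
  "forces_eq P p a b \<longleftrightarrow> p \<in> conds P \<and>
     (\<forall>c s q. opair c s \<in> elts a \<longrightarrow> le P q p \<longrightarrow> le P q s \<longrightarrow> forces_mem P q c b) \<and>
     (\<forall>c s q. opair c s \<in> elts b \<longrightarrow> le P q p \<longrightarrow> le P q s \<longrightarrow> forces_mem P q c a)"
  by (subst forces_eq.simps) (use le_conds in blast)

lemma forces_mem_iff:
  "forces_mem P p a b \<longleftrightarrow> p \<in> conds P \<and>
     (\<forall>q. le P q p \<longrightarrow> (\<exists>r c s. le P r q \<and> opair c s \<in> elts b \<and> le P r s \<and> forces_eq P r a c))"
  by (subst forces_mem.simps) (use le_conds in blast)

lemma forces_eq_conds: "forces_eq P p a b \<Longrightarrow> p \<in> conds P"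
  by (simp add: forces_eq_iff)

lemma forces_mem_conds: "forces_mem P p a b \<Longrightarrow> p \<in> conds P"
  by (simp add: forces_mem_iff)

lemma forces_eq_mono: "forces_eq P p a b \<Longrightarrow> le P q p \<Longrightarrow> forces_eq P q a b"
  unfolding forces_eq_iff[of p] forces_eq_iff[of q] using le_conds le_trans by blast

lemma forces_mem_mono: "forces_mem P p a b \<Longrightarrow> le P q p \<Longrightarrow> forces_mem P q a b"
  unfolding forces_mem_iff[of p] forces_mem_iff[of q] using le_conds le_trans by blast

lemma forces_mem_dense:
  assumes "p \<in> conds P" "\<And>q. le P q p \<Longrightarrow> \<exists>r. le P r q \<and> forces_mem P r a b"
  shows "forces_mem P p a b"
  unfolding forces_mem_iff[of p]
proof (intro conjI allI impI assms(1))
  fix q assume "le P q p"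
  then obtain r where r: "le P r q" "forces_mem P r a b"
    using assms(2) by blast
  moreover have "le P r r"
    using r le_conds le_refl by blast
  ultimately show "\<exists>r c s. le P r q \<and> opair c s \<in> elts b \<and> le P r s \<and> forces_eq P r a c"
    unfolding forces_mem_iff[of r] using le_trans by blast
qed

lemma forces_eq_elt:
  assumes "forces_eq P p a b" "opair c s \<in> elts a" "le P p s"
  shows "forces_mem P p c b"
  using assms le_refl unfolding forces_eq_iff[of p] by blast

lemma forces_eq_dense:
  assumes "p \<in> conds P" "\<And>q. le P q p \<Longrightarrow> \<exists>r. le P r q \<and> forces_eq P r a b"
  shows "forces_eq P p a b"
proof -
  \<comment> \<open>Stated for arbitrary \<open>a\<close> and \<open>b\<close>, with the density
    hypothesis as a premise, so that it serves both inclusions, the second through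
    \<open>sym\<close>.\<close>
  have *: "forces_mem P q c b"
    if c: "opair c s \<in> elts a" "le P q p" "le P q s"
      and ex: "\<And>q. le P q p \<Longrightarrow> \<exists>r. le P r q \<and> forces_eq P r a b" for a b c s q
  proof (rule forces_mem_dense)
    show "q \<in> conds P" using that le_conds by blast
    fix q' assume q': "le P q' q"
    then obtain r where r: "le P r q'" "forces_eq P r a b"
      using ex q' c(2) le_trans by meson
    then have "forces_mem P r c b"
      using forces_eq_elt c q' le_trans by meson
    then show "\<exists>r. le P r q' \<and> forces_mem P r c b"
      using r by blast
  qed
  have sym: "\<exists>r. le P r q \<and> forces_eq P r b a" if "le P q p" for q
    using assms(2)[OF that] unfolding forces_eq_iff by blast
  show ?thesis
    unfolding forces_eq_iff[of p] using *[of _ _ a _ b] *[of _ _ b _ a] assms sym by blast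
qed

lemma forces_eq_sym: "forces_eq P p a b \<Longrightarrow> forces_eq P p b a"
  unfolding forces_eq_iff[of p] by blast

lemma forces_eq_refl: "p \<in> conds P \<Longrightarrow> forces_eq P p a a"
proof (induction a arbitrary: p rule: dom_induct)
  case (step a)
  have "forces_mem P q c a" if "opair c s \<in> elts a" "le P q s" for c s q
    unfolding forces_mem_iff[of q] using that step le_conds le_trans le_refl by blast
  then show ?case
    unfolding forces_eq_iff[of p] using step.prems by blast
qed

lemma forces_memI:
  assumes "opair c s \<in> elts b" "le P p s" "forces_eq P p a c"
  shows "forces_mem P p a b"
  unfolding forces_mem_iff[of p]
  using assms le_conds le_trans le_refl forces_eq_mono by blast

lemma forces_memE:
  assumes "forces_mem P p a b" "le P q p"
  obtains r c s where "le P r q" "opair c s \<in> elts b" "le P r s" "forces_eq P r a c"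
  using assms unfolding forces_mem_iff[of p] by blast

lemma forces_eq_trans:
  "forces_eq P p a b \<Longrightarrow> forces_eq P p b c \<Longrightarrow> forces_eq P p a c"
proof (induction a arbitrary: p b c rule: dom_induct)
  case (step a)
  show ?case
    unfolding forces_eq_iff[of p]
  proof (intro conjI allI impI)
    show "p \<in> conds P" using step.prems forces_eq_conds by blast
  next
    fix d s q assume d: "opair d s \<in> elts a" "le P q p" "le P q s"
    show "forces_mem P q d c"
    proof (rule forces_mem_dense)
      show "q \<in> conds P" using d le_conds by blast
      fix q' assume q': "le P q' q"
      have "forces_mem P q d b"
        using forces_eq_elt[OF forces_eq_mono[OF step.prems(1) d(2)] d(1,3)] .
      then obtain r d' s' where r: "le P r q'" "opair d' s' \<in> elts b" "le P r s'" "forces_eq P r d d'"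
        using q' by (rule forces_memE)
      have rp: "le P r p" using r q' d le_trans by blast
      have "forces_mem P r d' c"
        using forces_eq_elt[OF forces_eq_mono[OF step.prems(2) rp] r(2,3)] .
      then obtain r' e t where r': "le P r' r" "opair e t \<in> elts c" "le P r' t" "forces_eq P r' d' e"
        using forces_memE le_refl le_conds r by metis
      have "forces_eq P r' d e"
        using step.IH[OF d(1) forces_eq_mono[OF r(4) r'(1)] r'(4)] .
      then show "\<exists>r. le P r q' \<and> forces_mem P r d c"
        using r' r forces_memI le_trans by blast
    qed
  next
    fix e s q assume e: "opair e s \<in> elts c" "le P q p" "le P q s"
    show "forces_mem P q e a"
    proof (rule forces_mem_dense)
      show "q \<in> conds P" using e le_conds by blast
      fix q' assume q': "le P q' q"
      have "forces_mem P q e b"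
        using forces_eq_elt[OF forces_eq_mono[OF forces_eq_sym[OF step.prems(2)] e(2)] e(1,3)] .
      then obtain r d' s' where r: "le P r q'" "opair d' s' \<in> elts b" "le P r s'" "forces_eq P r e d'"
        using q' by (rule forces_memE)
      have rp: "le P r p" using r q' e le_trans by blast
      have "forces_mem P r d' a"
        using forces_eq_elt[OF forces_eq_mono[OF forces_eq_sym[OF step.prems(1)] rp] r(2,3)] .
      then obtain r' d t where r': "le P r' r" "opair d t \<in> elts a" "le P r' t" "forces_eq P r' d' d"
        using forces_memE le_refl le_conds r by metis
      \<comment> \<open>The induction hypothesis speaks about elements of \<open>a\<close> only.
        Here the chain was found going from \<open>c\<close> back to \<open>a\<close>, so it is
        reversed and read as d, d', e.\<close>
      have "forces_eq P r' d e"
        using step.IH[OF r'(2) forces_eq_sym[OF r'(4)] forces_eq_sym[OF forces_eq_mono[OF r(4) r'(1)]]] .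
      then show "\<exists>r. le P r q' \<and> forces_mem P r e a"
        using r' r forces_memI forces_eq_sym le_trans by blast
    qed
  qed
qed

lemma forces_mem_cong:
  assumes "forces_mem P p a b" "forces_eq P p a a'" "forces_eq P p b b'"
  shows "forces_mem P p a' b'"
proof (rule forces_mem_dense)
  show "p \<in> conds P" using assms forces_mem_conds by blast
  fix q assume q: "le P q p"
  obtain r c s where r: "le P r q" "opair c s \<in> elts b" "le P r s" "forces_eq P r a c"
    using forces_memE[OF assms(1) q] by blast
  have rp: "le P r p" using r q le_trans by blast
  have "forces_mem P r c b'"
    using forces_eq_elt[OF forces_eq_mono[OF assms(3) rp] r(2,3)] .
  then obtain r' d t where r': "le P r' r" "opair d t \<in> elts b'" "le P r' t" "forces_eq P r' c d"
    using forces_memE le_refl le_conds r by metis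
  have "forces_eq P r' a' d"
    using forces_eq_trans forces_eq_sym forces_eq_mono assms(2) r(4) r' rp le_trans by metis
  then show "\<exists>r. le P r q \<and> forces_mem P r a' b'"
    using r' r forces_memI le_trans by blast
qed

section \<open>Forcing of arbitrary formulas\<close>

lemma forces_mono: "forces P p \<phi> \<rho> \<Longrightarrow> le P q p \<Longrightarrow> forces P q \<phi> \<rho>"
  by (induction \<phi> arbitrary: \<rho>) (auto intro: forces_mem_mono forces_eq_mono le_trans)

text \<open>Allows a condition to be strengthened before a witness is chosen. For negation: if some
  \<open>q\<close> below \<open>p\<close> forced \<open>\<phi>\<close>, an extension of it would
  force both \<open>\<phi>\<close> and its negation. Conjunctions and universal quantifiers reduce
  to their parts.\<close>

lemma forces_dense:
  assumes "p \<in> conds P" "\<And>q. le P q p \<Longrightarrow> \<exists>r. le P r q \<and> forces P r \<phi> \<rho>"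
  shows "forces P p \<phi> \<rho>"
  using assms
proof (induction \<phi> arbitrary: \<rho> p)
  case (Mem i j)
  then show ?case by (auto intro: forces_mem_dense)
next
  case (Eq i j)
  then show ?case by (auto intro: forces_eq_dense)
next
  case (Negate \<phi>)
  show ?case
  proof (simp, intro ballI impI notI)
    fix q assume q: "le P q p" "forces P q \<phi> \<rho>"
    then obtain r where r: "le P r q" "forces P r (Negate \<phi>) \<rho>"
      using Negate.prems by blast
    then show False
      using forces_mono[OF q(2) r(1)] le_refl le_conds by auto
  qed
next
  case (And \<phi> \<psi>)
  have "\<exists>r. le P r q \<and> forces P r \<phi> \<rho>" "\<exists>r. le P r q \<and> forces P r \<psi> \<rho>" if "le P q p" for q
    using And.prems(2)[OF that] by auto
  then show ?case
    using And.IH And.prems(1) by simp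
next
  case (Forall \<phi>)
  have "\<exists>r. le P r q \<and> forces P r \<phi> (case_nat a \<rho>)" if "le P q p" "is_name P a" for q a
    using Forall.prems(2)[OF that(1)] that(2) by auto
  then show ?case
    using Forall.IH Forall.prems(1) by simp
qed

lemma forces_eq_case_nat:
  "forces_eq P p a b \<Longrightarrow> (\<And>i. forces_eq P p (\<rho> i) (\<sigma> i)) \<Longrightarrow>
    forces_eq P p (case_nat a \<rho> i) (case_nat b \<sigma> i)"
  by (cases i) auto

lemma forces_cong:
  assumes "\<And>i. forces_eq P p (\<rho> i) (\<sigma> i)" "forces P p \<phi> \<rho>"
  shows "forces P p \<phi> \<sigma>"
  using assms
proof (induction \<phi> arbitrary: p \<rho> \<sigma>)
  case (Mem i j)
  then show ?case by (auto intro: forces_mem_cong)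
next
  case (Eq i j)
  then show ?case by (auto intro: forces_eq_trans forces_eq_sym)
next
  case (Negate \<phi>)
  \<comment> \<open>Negation is contravariant, so the induction hypothesis is used from
    \<open>\<sigma>\<close> to \<open>\<rho>\<close>, at the stronger condition
    \<open>q\<close>.\<close>
  have "\<not> forces P q \<phi> \<sigma>" if "le P q p" for q
  proof
    assume "forces P q \<phi> \<sigma>"
    then have "forces P q \<phi> \<rho>"
      by (rule Negate.IH[rotated]) (intro forces_eq_sym[OF forces_eq_mono[OF Negate.prems(1) that]])
    then show False
      using Negate.prems(2) that le_conds by auto
  qed
  then show ?case by simp
next
  case (And \<phi> \<psi>)
  then show ?case by (simp, blast)
next
  case (Forall \<phi>)
  show ?case
  proof (simp, intro allI impI)
    fix a assume "is_name P a"
    then have "forces P p \<phi> (case_nat a \<rho>)" using Forall.prems by simp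
    then show "forces P p \<phi> (case_nat a \<sigma>)"
      by (rule Forall.IH[rotated])
        (intro forces_eq_case_nat Forall.prems(1) forces_eq_refl forces_eq_conds[OF Forall.prems(1)])
  qed
qed

lemma forces_case_nat_cong:
  assumes "forces_eq P p a b" "forces P p \<phi> (case_nat a \<rho>)"
  shows "forces P p \<phi> (case_nat b \<rho>)"
  by (rule forces_cong[OF _ assms(2)])
    (intro forces_eq_case_nat assms(1) forces_eq_refl forces_eq_conds[OF assms(1)])

section \<open>Derived connectives and bounded quantifiers\<close>

lemma forces_Or:
  "forces P p (Or \<phi> \<psi>) \<rho> \<longleftrightarrow>
     (\<forall>q. le P q p \<longrightarrow> (\<exists>r. le P r q \<and> (forces P r \<phi> \<rho> \<or> forces P r \<psi> \<rho>)))"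
  unfolding Or_def using le_conds by (auto; blast)

text \<open>Unfolding \<open>Imp\<close> only excludes conditions below \<open>p\<close> that force
  \<open>\<phi>\<close> and the negation of \<open>\<psi>\<close>. Thus \<open>\<psi>\<close> is
  forced densely below each \<open>q\<close> forcing \<open>\<phi>\<close>, and
  \<open>forces_dense\<close> removes the double negation.\<close>

lemma forces_Imp:
  "forces P p (Imp \<phi> \<psi>) \<rho> \<longleftrightarrow> (\<forall>q. le P q p \<longrightarrow> forces P q \<phi> \<rho> \<longrightarrow> forces P q \<psi> \<rho>)"
proof
  assume L: "forces P p (Imp \<phi> \<psi>) \<rho>"
  show "\<forall>q. le P q p \<longrightarrow> forces P q \<phi> \<rho> \<longrightarrow> forces P q \<psi> \<rho>"
  proof (intro allI impI)
    fix q assume q: "le P q p" "forces P q \<phi> \<rho>"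
    show "forces P q \<psi> \<rho>"
    proof (rule forces_dense)
      show "q \<in> conds P" using q le_conds by blast
      fix q' assume q': "le P q' q"
      then have "le P q' p" "forces P q' \<phi> \<rho>" "q' \<in> conds P"
        using q le_trans forces_mono le_conds by blast+
      then show "\<exists>r. le P r q' \<and> forces P r \<psi> \<rho>"
        using L unfolding Imp_def by auto
    qed
  qed
next
  assume "\<forall>q. le P q p \<longrightarrow> forces P q \<phi> \<rho> \<longrightarrow> forces P q \<psi> \<rho>"
  then show "forces P p (Imp \<phi> \<psi>) \<rho>"
    unfolding Imp_def using le_refl by auto
qed

lemma forces_Iff:
  "forces P p (Iff \<phi> \<psi>) \<rho> \<longleftrightarrow> (\<forall>q. le P q p \<longrightarrow> forces P q \<phi> \<rho> \<longleftrightarrow> forces P q \<psi> \<rho>)"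
  unfolding Iff_def by (auto simp: forces_Imp)

lemma forces_Exists:
  "forces P p (Exists \<phi>) \<rho> \<longleftrightarrow>
     (\<forall>q. le P q p \<longrightarrow> (\<exists>r a. le P r q \<and> is_name P a \<and> forces P r \<phi> (case_nat a \<rho>)))"
  unfolding Exists_def using le_conds by (auto; blast)

lemma forces_BForallD:
  assumes "forces P p (BForall i \<phi>) \<rho>" "is_name P a" "forces_mem P p a (\<rho> i)"
  shows "forces P p \<phi> (case_nat a \<rho>)"
  using assms le_refl[OF forces_mem_conds[OF assms(3)]]
  unfolding BForall_def by (simp add: forces_Imp)

text \<open>Replaces the quantifier over all names by one over the domain of
  \<open>\<rho> i\<close>: a name forced into \<open>\<rho> i\<close> is, densely often, forced
  equal to a member of the domain, and names forced equal are interchangeable in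
  \<open>\<phi>\<close>.\<close>

lemma forces_BForall:
  assumes "is_name P (\<rho> i)"
  shows "forces P p (BForall i \<phi>) \<rho> \<longleftrightarrow>
    (\<forall>c s q. opair c s \<in> elts (\<rho> i) \<longrightarrow> le P q p \<longrightarrow> le P q s \<longrightarrow> forces P q \<phi> (case_nat c \<rho>))"
    (is "?L \<longleftrightarrow> ?R")
proof
  assume ?L
  then show ?R
    unfolding BForall_def
    using is_nameD[OF assms] forces_memI forces_eq_refl le_conds
    by (simp add: forces_Imp)
next
  assume R: ?R
  show ?L
    unfolding BForall_def
  proof (simp add: forces_Imp, intro allI impI)
    fix a q assume q: "le P q p" "forces_mem P q a (\<rho> i)"
    show "forces P q \<phi> (case_nat a \<rho>)"
    proof (rule forces_dense)
      show "q \<in> conds P" using q le_conds by blast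
      fix q' assume q': "le P q' q"
      obtain r c s where r: "le P r q'" "opair c s \<in> elts (\<rho> i)" "le P r s" "forces_eq P r a c"
        using forces_memE[OF q(2) q'] by blast
      then have "forces P r \<phi> (case_nat c \<rho>)"
        using R le_trans q q' by blast
      then show "\<exists>r. le P r q' \<and> forces P r \<phi> (case_nat a \<rho>)"
        using forces_case_nat_cong forces_eq_sym r by blast
    qed
  qed
qed

lemma forces_BExists:
  assumes "is_name P (\<rho> i)"
  shows "forces P p (BExists i \<phi>) \<rho> \<longleftrightarrow>
    (\<forall>q. le P q p \<longrightarrow> (\<exists>r c s. le P r q \<and> opair c s \<in> elts (\<rho> i) \<and> le P r s \<and>
       forces P r \<phi> (case_nat c \<rho>)))"
    (is "?L \<longleftrightarrow> ?R")
proof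
  assume L: ?L
  show ?R
  proof (intro allI impI)
    fix q assume "le P q p"
    then obtain r a where r: "le P r q" "forces_mem P r a (\<rho> i)" "forces P r \<phi> (case_nat a \<rho>)"
      using L unfolding BExists_def by (auto simp: forces_Exists)
    then obtain r' c s where r': "le P r' r" "opair c s \<in> elts (\<rho> i)" "le P r' s" "forces_eq P r' a c"
      using forces_memE le_refl le_conds by metis
    then have "forces P r' \<phi> (case_nat c \<rho>)"
      using forces_case_nat_cong forces_mono r(3) by blast
    then show "\<exists>r c s. le P r q \<and> opair c s \<in> elts (\<rho> i) \<and> le P r s \<and>
       forces P r \<phi> (case_nat c \<rho>)"
      using r r' le_trans by blast
  qed
next
  assume ?R
  then show ?L
    unfolding BExists_def
    using is_nameD[OF assms] forces_memI forces_eq_refl le_conds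
    by (simp add: forces_Exists) blast
qed

section \<open>Check names: sets of V inside the extension\<close>

lemma forces_mem_check:
  "forces_mem P p a (check P x) \<longleftrightarrow> p \<in> conds P \<and>
     (\<forall>q. le P q p \<longrightarrow> (\<exists>r. le P r q \<and> (\<exists>y\<in>elts x. forces_eq P r a (check P y))))"
  unfolding forces_mem_iff[of p] opair_in_check using le_conds le_refl by blast

text \<open>Induction on \<open>x\<close>, with \<open>p\<close> and \<open>y\<close> arbitrary: a
  forced membership becomes, at some stronger condition, a forced equality of check names of
  elements, which the hypothesis turns into a true equality.\<close>

lemma forces_eq_check_iff [simp]:
  assumes "p \<in> conds P"
  shows "forces_eq P p (check P x) (check P y) \<longleftrightarrow> x = y"
proof
  show "forces_eq P p (check P x) (check P y) \<Longrightarrow> x = y"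
    using assms
  proof (induction x arbitrary: p y rule: wf_induct_rule[OF foundation])
    case (1 x)
    have "z \<in> elts y" if "z \<in> elts x" for z
    proof -
      have "forces_mem P p (check P z) (check P y)"
        using forces_eq_elt[OF 1(2)] opair_in_check that 1 le_refl by blast
      then show ?thesis
        unfolding forces_mem_check using 1 that le_refl le_conds by blast
    qed
    moreover have "z \<in> elts x" if "z \<in> elts y" for z
    proof -
      have "forces_mem P p (check P z) (check P x)"
        using forces_eq_elt[OF forces_eq_sym[OF 1(2)]] opair_in_check that 1 le_refl by blast
      then obtain r w where "le P r p" "w \<in> elts x" "forces_eq P r (check P z) (check P w)"
        unfolding forces_mem_check using 1 le_refl by blast
      then show ?thesis
        using 1(1)[of w r z] forces_eq_sym le_conds by auto
    qed
    ultimately show ?case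
      using extensionality by blast
  qed
qed (use assms forces_eq_refl in simp)

lemma forces_mem_check_iff [simp]:
  assumes "p \<in> conds P"
  shows "forces_mem P p (check P x) (check P y) \<longleftrightarrow> x \<in> elts y"
  unfolding forces_mem_check using assms le_refl le_conds forces_eq_check_iff by metis

lemma forces_BForall_check:
  assumes "\<rho> i = check P x" "p \<in> conds P"
  shows "forces P p (BForall i \<phi>) \<rho> \<longleftrightarrow> (\<forall>y\<in>elts x. forces P p \<phi> (case_nat (check P y) \<rho>))"
    (is "?L \<longleftrightarrow> ?R")
proof
  assume ?L
  then show ?R
    using forces_BForallD[OF _ is_name_check] assms by simp
next
  assume R: ?R
  have name: "is_name P (\<rho> i)" by (simp add: assms)
  show ?L
    unfolding forces_BForall[where \<rho> = \<rho>, OF name] assms(1) opair_in_check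
    using R forces_mono by blast
qed

lemma forces_BExists_check:
  assumes "\<rho> i = check P x"
  shows "forces P p (BExists i \<phi>) \<rho> \<longleftrightarrow>
    (\<forall>q. le P q p \<longrightarrow> (\<exists>r. le P r q \<and> (\<exists>y\<in>elts x. forces P r \<phi> (case_nat (check P y) \<rho>))))"
proof -
  have name: "is_name P (\<rho> i)" by (simp add: assms)
  show ?thesis
    unfolding forces_BExists[where \<rho> = \<rho>, OF name] assms(1) opair_in_check
  proof (intro iff_allI imp_cong refl iffI)
    fix q
    assume "\<exists>r. le P r q \<and> (\<exists>y\<in>elts x. forces P r \<phi> (case_nat (check P y) \<rho>))"
    then obtain r y where "le P r q" "y \<in> elts x" "forces P r \<phi> (case_nat (check P y) \<rho>)"
      by blast
    moreover have "r \<in> conds P" "le P r r"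
      using \<open>le P r q\<close> le_conds le_refl by blast+
    ultimately show "\<exists>r c s. le P r q \<and> (s \<in> conds P \<and> (\<exists>y\<in>elts x. c = check P y)) \<and> le P r s \<and>
        forces P r \<phi> (case_nat c \<rho>)"
      by blast
  qed blast
qed

section \<open>Names determined by formulas: pairs, successors, omega\<close>

lemma forces_eq_ext:
  assumes "p \<in> conds P" "is_name P a" "is_name P b"
    and "\<And>c q. is_name P c \<Longrightarrow> le P q p \<Longrightarrow> forces_mem P q c a \<longleftrightarrow> forces_mem P q c b"
  shows "forces_eq P p a b"
  unfolding forces_eq_iff[of p]
  using assms is_nameD forces_memI forces_eq_refl le_conds by meson

lemma forces_ExistsI:
  assumes "is_name P a" "forces P p \<phi> (case_nat a \<rho>)"
  shows "forces P p (Exists \<phi>) \<rho>"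
  unfolding forces_Exists using assms forces_mono le_conds le_refl by blast

lemma forces_BExistsI:
  assumes "is_name P a" "forces_mem P p a (\<rho> i)" "forces P p \<phi> (case_nat a \<rho>)"
  shows "forces P p (BExists i \<phi>) \<rho>"
  unfolding BExists_def by (rule forces_ExistsI) (use assms in auto)

lemma forces_mem_checkI:
  "y \<in> elts x \<Longrightarrow> forces_eq P p a (check P y) \<Longrightarrow> forces_mem P p a (check P x)"
  unfolding forces_mem_check using forces_eq_mono le_refl le_conds forces_eq_conds by blast

lemma forces_mem_checkE:
  assumes "forces_mem P p a (check P x)" "le P q p"
  obtains r y where "le P r q" "y \<in> elts x" "forces_eq P r a (check P y)"
  using assms unfolding forces_mem_check by blast

lemma forces_mem_pair:
  "forces_mem P p a (check P (vset {x, y})) \<longleftrightarrow> p \<in> conds P \<and>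
     (\<forall>q. le P q p \<longrightarrow> (\<exists>r. le P r q \<and>
        (forces_eq P r a (check P x) \<or> forces_eq P r a (check P y))))"
  by (simp add: forces_mem_check)

lemma forces_mem_succ:
  assumes s: "elts s = insert n (elts n)" and p: "p \<in> conds P"
  shows "forces_mem P p a (check P s) \<longleftrightarrow>
     (\<forall>q. le P q p \<longrightarrow> (\<exists>r. le P r q \<and>
        (forces_mem P r a (check P n) \<or> forces_eq P r a (check P n))))" (is "?L \<longleftrightarrow> ?R")
proof
  assume L: ?L
  show ?R
  proof (intro allI impI)
    fix q assume "le P q p"
    with L obtain r y where r: "le P r q" "y \<in> elts s" "forces_eq P r a (check P y)"
      by (rule forces_mem_checkE)
    then have "forces_mem P r a (check P n) \<or> forces_eq P r a (check P n)"
      using s forces_mem_checkI by auto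
    then show "\<exists>r. le P r q \<and> (forces_mem P r a (check P n) \<or> forces_eq P r a (check P n))"
      using r by blast
  qed
next
  assume R: ?R
  show ?L
  proof (rule forces_mem_dense[OF p])
    fix q assume q: "le P q p"
    with R obtain r where r: "le P r q"
        "forces_mem P r a (check P n) \<or> forces_eq P r a (check P n)"
      by blast
    from r(2) have "forces_mem P r a (check P s)"
    proof
      assume mem: "forces_mem P r a (check P n)"
      show ?thesis
      proof (rule forces_mem_dense)
        show "r \<in> conds P" using r le_conds by blast
        fix q' assume "le P q' r"
        with mem obtain r' y where "le P r' q'" "y \<in> elts n" "forces_eq P r' a (check P y)"
          by (rule forces_mem_checkE)
        then show "\<exists>r'. le P r' q' \<and> forces_mem P r' a (check P s)"
          using s forces_mem_checkI by blast
      qed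
    qed (use s forces_mem_checkI in blast)
    then show "\<exists>r. le P r q \<and> forces_mem P r a (check P s)"
      using r by blast
  qed
qed

text \<open>Common core of the pair and successor formulas, both of which say that the elements of
  \<open>\<rho> z\<close> are exactly those satisfying \<open>\<psi>\<close>. It identifies an
  arbitrary name with the check name of the intended set.\<close>

lemma forces_extensional_fm:
  assumes "p \<in> conds P" "is_name P (\<rho> z)" "is_name P b"
    and "\<And>c q. is_name P c \<Longrightarrow> le P q p \<Longrightarrow> forces P q \<psi> (case_nat c \<rho>) \<longleftrightarrow> forces_mem P q c b"
  shows "forces P p (Forall (Iff (Mem 0 (z + 1)) \<psi>)) \<rho> \<longleftrightarrow> forces_eq P p (\<rho> z) b"
    (is "?L \<longleftrightarrow> ?R")
proof
  assume ?L
  then have "forces_mem P q c (\<rho> z) \<longleftrightarrow> forces_mem P q c b" if "is_name P c" "le P q p" for c q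
    using assms(4)[OF that] that by (simp add: forces_Iff)
  then show ?R
    by (rule forces_eq_ext[OF assms(1-3)])
next
  assume R: ?R
  have "forces_mem P q c (\<rho> z) \<longleftrightarrow> forces_mem P q c b" if q: "le P q p" for c q
  proof -
    have e: "forces_eq P q (\<rho> z) b" "forces_eq P q c c"
      using forces_eq_mono[OF R q] forces_eq_refl le_conds q by auto
    show ?thesis
      using forces_mem_cong[OF _ e(2) e(1)] forces_mem_cong[OF _ e(2) forces_eq_sym[OF e(1)]] by blast
  qed
  then show ?L
    using assms(4) by (simp add: forces_Iff)
qed

lemma forces_empty_fm:
  assumes "p \<in> conds P" "is_name P (\<rho> z)"
  shows "forces P p (empty_fm z) \<rho> \<longleftrightarrow> forces_eq P p (\<rho> z) (check P (vnat 0))" (is "?L \<longleftrightarrow> ?R")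
proof -
  have no: "\<not> forces_mem P q c (check P (vnat 0))" for q c
    unfolding forces_mem_check using le_refl by auto
  show ?thesis
  proof
    assume L: ?L
    have "\<not> forces_mem P q c (\<rho> z)" if "is_name P c" "le P q p" for q c
      using L that le_conds by (auto simp: empty_fm_def)
    then show ?R
      by (intro forces_eq_ext assms is_name_check) (simp add: no)
  next
    assume R: ?R
    have "\<not> forces_mem P q c (\<rho> z)" if q: "le P q p" for q c
      using no forces_mem_cong[OF _ forces_eq_refl forces_eq_mono[OF R q]] le_conds q by blast
    then show ?L
      by (simp add: empty_fm_def)
  qed
qed

lemma forces_pair_fm:
  assumes "p \<in> conds P" "is_name P (\<rho> z)" "\<rho> a = check P x" "\<rho> b = check P y"
  shows "forces P p (pair_fm a b z) \<rho> \<longleftrightarrow> forces_eq P p (\<rho> z) (check P (vset {x, y}))"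
  unfolding pair_fm_def
  by (intro forces_extensional_fm assms(1,2) is_name_check)
    (use le_conds in \<open>auto simp: forces_Or forces_mem_pair assms\<close>)

lemma forces_succ_fm:
  assumes "p \<in> conds P" "is_name P (\<rho> s)" "\<rho> n = check P (vnat k)"
  shows "forces P p (succ_fm n s) \<rho> \<longleftrightarrow> forces_eq P p (\<rho> s) (check P (vnat (Suc k)))"
  unfolding succ_fm_def
proof (intro forces_extensional_fm assms(1,2) is_name_check)
  fix c q assume "le P q p"
  then show "forces P q (Or (Mem 0 (n + 1)) (Eq 0 (n + 1))) (case_nat c \<rho>) \<longleftrightarrow>
      forces_mem P q c (check P (vnat (Suc k)))"
    using le_conds by (subst forces_mem_succ[OF elts_vnat_Suc]) (auto simp: forces_Or assms)
qed

lemma forces_opair_fm: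
  assumes p: "p \<in> conds P" and z: "is_name P (\<rho> z)" and ab: "\<rho> a = check P x" "\<rho> b = check P y"
  shows "forces P p (opair_fm a b z) \<rho> \<longleftrightarrow> forces_eq P p (\<rho> z) (check P (opair x y))"
    (is "?L \<longleftrightarrow> ?R")
proof -
  let ?u = "check P (vset {x, x})" and ?v = "check P (vset {x, y})"
  \<comment> \<open>\<open>{x, x}\<close> in place of \<open>{x}\<close> matches
    \<open>pair_fm (a+2) (a+2) 1\<close>, so \<open>forces_pair_fm\<close> covers both
    components.\<close>
  have op: "opair x y = vset {vset {x, x}, vset {x, y}}"
    by (simp add: opair_def)
  let ?F = "And (pair_fm (a+2) (a+2) 1) (And (pair_fm (a+2) (b+2) 0) (pair_fm 1 0 (z+2)))"
  have pair: "forces P q (pair_fm 1 0 (z+2)) (case_nat ?v (case_nat ?u \<rho>)) \<longleftrightarrow>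
      forces_eq P q (\<rho> z) (check P (opair x y))" if "q \<in> conds P" for q
    unfolding op by (subst forces_pair_fm[OF that, of _ _ _ "vset {x, x}" _ "vset {x, y}"]) (simp_all add: z)
  show ?thesis
  proof
    assume L: ?L
    show ?R
    proof (rule forces_eq_dense[OF p])
      fix q assume "le P q p"
      then obtain r' u where r': "le P r' q" "is_name P u" "forces P r' (Exists ?F) (case_nat u \<rho>)"
        using L unfolding opair_fm_def forces_Exists[of p] by blast
      then obtain r v where r: "le P r r'" "is_name P v" "forces P r ?F (case_nat v (case_nat u \<rho>))"
        using le_refl le_conds unfolding forces_Exists[of r'] by blast
      have rc: "r \<in> conds P" using r le_conds by blast
      have uv: "forces_eq P r u ?u" "forces_eq P r v ?v"
        using r(3) forces_pair_fm[OF rc, of "case_nat v (case_nat u \<rho>)" 1 "a+2" x "a+2" x]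
          forces_pair_fm[OF rc, of "case_nat v (case_nat u \<rho>)" 0 "a+2" x "b+2" y] r(2) r'(2) ab
        by simp_all
      \<comment> \<open>The witnesses \<open>u\<close> and \<open>v\<close> are arbitrary names;
        once forced equal to check names they can be replaced by these in the outer pair
        formula.\<close>
      have "forces_eq P r (case_nat v (case_nat u \<rho>) i) (case_nat ?v (case_nat ?u \<rho>) i)" for i
        by (intro forces_eq_case_nat uv forces_eq_refl rc)
      then have "forces P r (pair_fm 1 0 (z+2)) (case_nat ?v (case_nat ?u \<rho>))"
        by (rule forces_cong) (use r(3) in simp)
      then show "\<exists>r. le P r q \<and> forces_eq P r (\<rho> z) (check P (opair x y))"
        using pair[OF rc] r(1) r'(1) le_trans by blast
    qed
  next
    assume R: ?R
    show ?L
      unfolding opair_fm_def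
    proof (intro forces_ExistsI)
      show "forces P p ?F (case_nat ?v (case_nat ?u \<rho>))"
        using R pair[OF p] forces_pair_fm[OF p, of "case_nat ?v (case_nat ?u \<rho>)" 1 "a+2" x "a+2" x]
          forces_pair_fm[OF p, of "case_nat ?v (case_nat ?u \<rho>)" 0 "a+2" x "b+2" y] ab
        by (simp add: forces_eq_refl p)
    qed simp_all
  qed
qed

lemma forces_inductive_fm_vomega:
  assumes "p \<in> conds P" "\<rho> w = check P vomega"
  shows "forces P p (inductive_fm w) \<rho>"
proof -
  have "forces P p (BExists w (empty_fm 0)) \<rho>"
    by (rule forces_BExistsI[of "check P (vnat 0)"])
      (use assms in \<open>simp_all add: forces_empty_fm forces_eq_refl\<close>)
  moreover have "forces P p (BExists (w + 1) (succ_fm 1 0)) (case_nat (check P (vnat n)) \<rho>)" for n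
    by (rule forces_BExistsI[of "check P (vnat (Suc n))"])
      (use assms in \<open>simp_all add: forces_succ_fm[where k = n] forces_eq_refl\<close>)
  ultimately show ?thesis
    by (auto simp: inductive_fm_def forces_BForall_check[where \<rho> = \<rho> and i = w, OF assms(2,1)])
qed

text \<open>Provides the minimality half of \<open>omega_fm\<close>. Since \<open>vomega\<close>
  consists of the numerals of the logic, an induction on \<open>n\<close> outside the forcing
  relation suffices.\<close>

lemma forces_inductive_fmD:
  assumes "is_name P (\<rho> w)" "forces P p (inductive_fm w) \<rho>" "p \<in> conds P"
  shows "forces_mem P p (check P (vnat n)) (\<rho> w)"
proof (induction n)
  case 0
  have ex: "forces P p (BExists w (empty_fm 0)) \<rho>"
    using assms(2) by (simp add: inductive_fm_def)
  show ?case
  proof (rule forces_mem_dense[OF assms(3)])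
    fix q assume "le P q p"
    then obtain r c s where r: "le P r q" "opair c s \<in> elts (\<rho> w)" "le P r s"
        "forces P r (empty_fm 0) (case_nat c \<rho>)"
      using ex unfolding forces_BExists[where \<rho> = \<rho>, OF assms(1)] by blast
    then have "forces_eq P r c (check P (vnat 0))"
      using le_conds is_nameD[OF assms(1) r(2)] by (simp add: forces_empty_fm)
    then show "\<exists>r. le P r q \<and> forces_mem P r (check P (vnat 0)) (\<rho> w)"
      using forces_memI forces_eq_sym r by blast
  qed
next
  case (Suc n)
  have "forces P p (BForall w (BExists (w + 1) (succ_fm 1 0))) \<rho>"
    using assms(2) by (simp add: inductive_fm_def)
  then have ex: "forces P p (BExists (w + 1) (succ_fm 1 0)) (case_nat (check P (vnat n)) \<rho>)"
    using Suc by (intro forces_BForallD) auto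
  show ?case
  proof (rule forces_mem_dense[OF assms(3)])
    fix q assume "le P q p"
    then obtain r c s where r: "le P r q" "opair c s \<in> elts (\<rho> w)" "le P r s"
        "forces P r (succ_fm 1 0) (case_nat c (case_nat (check P (vnat n)) \<rho>))"
      using ex assms(1) by (subst (asm) forces_BExists) auto
    then have "forces_eq P r c (check P (vnat (Suc n)))"
      using le_conds is_nameD[OF assms(1) r(2)] by (simp add: forces_succ_fm[where k = n])
    then show "\<exists>r. le P r q \<and> forces_mem P r (check P (vnat (Suc n))) (\<rho> w)"
      using forces_memI forces_eq_sym r by blast
  qed
qed

lemma forces_subset_fm:
  assumes "is_name P (\<rho> a)"
  shows "forces P p (subset_fm a b) \<rho> \<longleftrightarrow>
    (\<forall>c s q. opair c s \<in> elts (\<rho> a) \<longrightarrow> le P q p \<longrightarrow> le P q s \<longrightarrow> forces_mem P q c (\<rho> b))"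
  by (simp add: subset_fm_def forces_BForall assms)

lemma forces_subset_fm_check:
  assumes "\<rho> a = check P x" "p \<in> conds P"
  shows "forces P p (subset_fm a b) \<rho> \<longleftrightarrow> (\<forall>y\<in>elts x. forces_mem P p (check P y) (\<rho> b))"
  by (simp add: subset_fm_def forces_BForall_check[where \<rho> = \<rho>, OF assms])

lemma forces_omega_fm:
  assumes "p \<in> conds P" "\<rho> w = check P vomega"
  shows "forces P p (omega_fm w) \<rho>"
proof -
  have "forces P q (subset_fm (w + 1) 0) (case_nat a \<rho>)"
    if "is_name P a" "le P q p" "forces P q (inductive_fm 0) (case_nat a \<rho>)" for a q
    using forces_inductive_fmD[of "case_nat a \<rho>" 0 q] that le_conds[OF that(2)] assms
    by (subst forces_subset_fm_check[where x = vomega]) auto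
  then show ?thesis
    using forces_inductive_fm_vomega[where \<rho> = \<rho>, OF assms] by (simp add: omega_fm_def forces_Imp)
qed

text \<open>A name for \<open>{g y | y \<in> Y, R y s for some s in the generic filter}\<close>. For the name \<open>A\<close> of the main argument,
  \<open>R y s\<close> says that \<open>s\<close> forces \<open>y \<in> A\<close>, so that \<open>g y = y\<close> names \<open>A \<inter> Y\<close>, and \<open>g y = \<langle>y, e y\<rangle>\<close>
  names the restriction of \<open>e\<close> to it.\<close>

definition restr_name :: "('v \<Rightarrow> 'v) \<Rightarrow> 'v set \<Rightarrow> ('v \<Rightarrow> 'v \<Rightarrow> bool) \<Rightarrow> 'v" where
  "restr_name g Y R = vset {opair (check P (g y)) s | y s. y \<in> Y \<and> s \<in> conds P \<and> R y s}"

lemma elts_restr_name: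
  assumes "small Y"
  shows "elts (restr_name g Y R) = {opair (check P (g y)) s | y s. y \<in> Y \<and> s \<in> conds P \<and> R y s}"
  unfolding restr_name_def
proof (intro elts_vset_small small_subset[OF small_Times_image[OF assms small_conds[of P]]] subsetI)
  fix z assume "z \<in> {opair (check P (g y)) s | y s. y \<in> Y \<and> s \<in> conds P \<and> R y s}"
  then show "z \<in> (\<lambda>(y, s). opair (check P (g y)) s) ` (Y \<times> conds P)"
    by auto
qed

lemma opair_in_restr_name:
  assumes "small Y"
  shows "opair c s \<in> elts (restr_name g Y R) \<longleftrightarrow>
    s \<in> conds P \<and> (\<exists>y\<in>Y. c = check P (g y) \<and> R y s)"
  by (auto simp: elts_restr_name assms)

lemma is_name_restr_name: "small Y \<Longrightarrow> is_name P (restr_name g Y R)"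
  by (subst is_name_iff) (auto simp: elts_restr_name)

section \<open>Injections and countability in the extension\<close>

lemma forces_BForall_restr_name:
  assumes "small Y" "\<rho> i = restr_name g Y R"
  shows "forces P p (BForall i \<phi>) \<rho> \<longleftrightarrow>
    (\<forall>y\<in>Y. \<forall>s q. R y s \<longrightarrow> le P q p \<longrightarrow> le P q s \<longrightarrow> forces P q \<phi> (case_nat (check P (g y)) \<rho>))"
proof -
  have name: "is_name P (\<rho> i)" by (simp add: assms is_name_restr_name)
  show ?thesis
    unfolding forces_BForall[where \<rho> = \<rho>, OF name] assms(2) opair_in_restr_name[OF assms(1)]
    using le_conds by blast
qed

lemma forces_BExists_restr_nameI:
  assumes "small Y" "\<rho> i = restr_name g Y R" "y \<in> Y" "R y s" "le P p s"
    and "forces P p \<phi> (case_nat (check P (g y)) \<rho>)"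
  shows "forces P p (BExists i \<phi>) \<rho>"
proof (rule forces_BExistsI[OF is_name_check _ assms(6)])
  show "forces_mem P p (check P (g y)) (\<rho> i)"
    using assms(2-5) le_conds[OF assms(5)]
    by (intro forces_memI[of _ s] forces_eq_refl) (auto simp: opair_in_restr_name[OF assms(1)])
qed

lemma forces_app_fmI:
  assumes "small Y" "\<rho> i = restr_name (\<lambda>y. opair y (e y)) Y R" "y \<in> Y" "R y s" "le P p s"
    and "\<rho> j = check P y" "\<rho> k = check P (e y)"
  shows "forces P p (app_fm i j k) \<rho>"
  unfolding app_fm_def
  by (rule forces_BExists_restr_nameI[where \<rho> = \<rho> and g = "\<lambda>y. opair y (e y)" and R = R, OF assms(1-5)])
    (use assms le_conds[OF assms(5)] in \<open>simp add: forces_opair_fm[where x = y and y = "e y"] forces_eq_refl\<close>)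

text \<open>The graph consists of check names of pairs of V, and a forced equality of check names is
  a true one. So a single instance of \<open>app_fm\<close> below \<open>p\<close> already reveals
  the value of \<open>e\<close> in V.\<close>

lemma forces_app_fmD:
  assumes "forces P p (app_fm i j k) \<rho>" "p \<in> conds P"
    and "small Y" "\<rho> i = restr_name (\<lambda>y. opair y (e y)) Y R"
    and "\<rho> j = check P y" "\<rho> k = check P n"
  shows "y \<in> Y \<and> n = e y"
proof -
  have name: "is_name P (\<rho> i)" by (simp add: assms is_name_restr_name)
  obtain r c s where r: "le P r p" "opair c s \<in> elts (\<rho> i)"
      "forces P r (opair_fm (j + 1) (k + 1) 0) (case_nat c \<rho>)"
    using assms(1) le_refl[OF assms(2)]
    unfolding app_fm_def forces_BExists[where \<rho> = \<rho>, OF name] by blast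
  then obtain y' where y': "y' \<in> Y" "c = check P (opair y' (e y'))"
    using assms(3,4) by (auto simp: opair_in_restr_name)
  have "r \<in> conds P" using r le_conds by blast
  then have "opair y' (e y') = opair y n"
    using r(3) by (auto simp add: forces_opair_fm[where x = y and y = n] y' assms)
  then show ?thesis
    using y' by auto
qed

text \<open>Domain and graph are cut out by the same \<open>R\<close>, so a condition that puts
  \<open>y\<close> into the domain puts the pair of \<open>y\<close> and \<open>e y\<close> into the
  graph. Facts 1 to 4 follow the conjuncts: typing, totality, single values, injectivity. The last
  two read values off by \<open>forces_app_fmD\<close>; the fourth then uses injectivity of
  \<open>e\<close> in V.\<close>

lemma forces_injection_fm:
  assumes p: "p \<in> conds P" and Y: "small Y" "inj_on e Y" "e ` Y \<subseteq> elts C"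
    and \<rho>: "\<rho> f = restr_name (\<lambda>y. opair y (e y)) Y R" "\<rho> b = restr_name (\<lambda>y. y) Y R" "\<rho> c = check P C"
  shows "forces P p (injection_fm f b c) \<rho>"
proof -
  \<comment> \<open>\<open>eval_nat_numeral\<close> writes the indices 2 and 3 as successors, so
    that \<open>case_nat\<close> evaluates.\<close>
  note simps = eval_nat_numeral \<rho>
  have 1: "forces P p (BForall f (BExists (b+1) (BExists (c+2) (opair_fm 1 0 2)))) \<rho>"
    unfolding forces_BForall_restr_name[where \<rho> = \<rho>, OF Y(1) \<rho>(1)]
  proof (intro ballI allI impI)
    fix y s q assume y: "y \<in> Y" "R y s" "le P q p" "le P q s"
    then have q: "q \<in> conds P" using le_conds by blast
    show "forces P q (BExists (b+1) (BExists (c+2) (opair_fm 1 0 2)))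
        (case_nat (check P (opair y (e y))) \<rho>)"
    proof (rule forces_BExists_restr_nameI[where g = "\<lambda>y. y" and R = R, OF Y(1) _ y(1,2,4)])
      show "forces P q (BExists (c+2) (opair_fm 1 0 2))
          (case_nat (check P y) (case_nat (check P (opair y (e y))) \<rho>))"
        by (rule forces_BExistsI[of "check P (e y)"])
          (use y Y q in \<open>auto simp: simps forces_opair_fm[where x = y and y = "e y"] forces_eq_refl\<close>)
    qed (simp add: \<rho>)
  qed
  have 2: "forces P p (BForall b (BExists (c+1) (app_fm (f+2) 1 0))) \<rho>"
    unfolding forces_BForall_restr_name[where \<rho> = \<rho>, OF Y(1) \<rho>(2)]
  proof (intro ballI allI impI)
    fix y s q assume y: "y \<in> Y" "R y s" "le P q p" "le P q s"
    then have q: "q \<in> conds P" using le_conds by blast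
    show "forces P q (BExists (c+1) (app_fm (f+2) 1 0)) (case_nat (check P y) \<rho>)"
    proof (rule forces_BExistsI[of "check P (e y)"])
      show "forces P q (app_fm (f+2) 1 0) (case_nat (check P (e y)) (case_nat (check P y) \<rho>))"
        by (rule forces_app_fmI[where e = e and R = R, OF Y(1) _ y(1,2,4)]) (simp_all add: simps)
    qed (use y Y q in \<open>auto simp: \<rho>\<close>)
  qed
  have 3: "forces P p (BForall b (BForall (c+1) (BForall (c+2)
      (Imp (And (app_fm (f+3) 2 1) (app_fm (f+3) 2 0)) (Eq 1 0))))) \<rho>"
    unfolding forces_BForall_restr_name[where \<rho> = \<rho>, OF Y(1) \<rho>(2)]
  proof (intro ballI allI impI)
    fix y s q assume y: "y \<in> Y" "R y s" "le P q p" "le P q s"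
    then have q: "q \<in> conds P" using le_conds by blast
    have "forces P q (Imp (And (app_fm (f+3) 2 1) (app_fm (f+3) 2 0)) (Eq 1 0))
      (case_nat (check P n) (case_nat (check P m) (case_nat (check P y) \<rho>)))" (is "forces P q _ ?\<sigma>") for m n
      unfolding forces_Imp
    proof (intro allI impI)
      fix r assume r: "le P r q" "forces P r (And (app_fm (f+3) 2 1) (app_fm (f+3) 2 0)) ?\<sigma>"
      then have rc: "r \<in> conds P" using le_conds by blast
      have "m = e y"
        using r(2) forces_app_fmD[where e = e and R = R and \<rho> = ?\<sigma> and i = "f+3" and j = 2 and k = 1 and n = m, OF _ rc Y(1)]
        by (simp add: simps)
      moreover have "n = e y"
        using r(2) forces_app_fmD[where e = e and R = R and \<rho> = ?\<sigma> and i = "f+3" and j = 2 and k = 0 and n = n, OF _ rc Y(1)]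
        by (simp add: simps)
      ultimately show "forces P r (Eq 1 0) ?\<sigma>"
        using rc by (simp add: simps)
    qed
    then show "forces P q (BForall (c+1) (BForall (c+2)
        (Imp (And (app_fm (f+3) 2 1) (app_fm (f+3) 2 0)) (Eq 1 0)))) (case_nat (check P y) \<rho>)"
      using q by (simp add: forces_BForall_check[where x = C] simps)
  qed
  have 4: "forces P p (BForall b (BForall (b+1) (BForall (c+2)
      (Imp (And (app_fm (f+3) 2 0) (app_fm (f+3) 1 0)) (Eq 2 1))))) \<rho>"
    unfolding forces_BForall_restr_name[where \<rho> = \<rho>, OF Y(1) \<rho>(2)]
  proof (intro ballI allI impI)
    fix y s q assume y: "y \<in> Y" "R y s" "le P q p" "le P q s"
    show "forces P q (BForall (b+1) (BForall (c+2)
        (Imp (And (app_fm (f+3) 2 0) (app_fm (f+3) 1 0)) (Eq 2 1)))) (case_nat (check P y) \<rho>)"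
    proof (subst forces_BForall_restr_name[where g = "\<lambda>y. y" and R = R, OF Y(1)])
      show "case_nat (check P y) \<rho> (b+1) = restr_name (\<lambda>y. y) Y R" by (simp add: \<rho>)
      show "\<forall>y'\<in>Y. \<forall>s r. R y' s \<longrightarrow> le P r q \<longrightarrow> le P r s \<longrightarrow>
          forces P r (BForall (c+2) (Imp (And (app_fm (f+3) 2 0) (app_fm (f+3) 1 0)) (Eq 2 1)))
            (case_nat (check P y') (case_nat (check P y) \<rho>))"
      proof (intro ballI allI impI)
        fix y' s' r assume y': "y' \<in> Y" "R y' s'" "le P r q" "le P r s'"
        then have rc: "r \<in> conds P" using le_conds by blast
        have "forces P r (Imp (And (app_fm (f+3) 2 0) (app_fm (f+3) 1 0)) (Eq 2 1))
          (case_nat (check P n) (case_nat (check P y') (case_nat (check P y) \<rho>)))"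
          (is "forces P r _ ?\<sigma>") for n
          unfolding forces_Imp
        proof (intro allI impI)
          fix t assume t: "le P t r" "forces P t (And (app_fm (f+3) 2 0) (app_fm (f+3) 1 0)) ?\<sigma>"
          then have tc: "t \<in> conds P" using le_conds by blast
          have "n = e y"
            using t(2) forces_app_fmD[where e = e and R = R and \<rho> = ?\<sigma> and i = "f+3" and j = 2 and k = 0 and n = n, OF _ tc Y(1)]
            by (simp add: simps)
          moreover have "n = e y'"
            using t(2) forces_app_fmD[where e = e and R = R and \<rho> = ?\<sigma> and i = "f+3" and j = 1 and k = 0 and n = n, OF _ tc Y(1)]
            by (simp add: simps)
          ultimately have "y = y'"
            using y(1) y'(1) Y(2) by (auto dest: inj_onD)
          then show "forces P t (Eq 2 1) ?\<sigma>"
            using tc by (simp add: simps)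
        qed
        then show "forces P r (BForall (c+2) (Imp (And (app_fm (f+3) 2 0) (app_fm (f+3) 1 0)) (Eq 2 1)))
            (case_nat (check P y') (case_nat (check P y) \<rho>))"
          using rc by (simp add: forces_BForall_check[where x = C] simps)
      qed
    qed
  qed
  show ?thesis
    unfolding injection_fm_def using 1 2 3 4 by simp
qed

text \<open>An enumeration of \<open>Y\<close> in V, composed with the numerals, serves as
  \<open>e\<close>; its restriction to the named subset of \<open>Y\<close> is again an injection
  into omega.\<close>

lemma forces_countable_fm:
  assumes "p \<in> conds P" "small Y" "countable Y" "\<rho> b = restr_name (\<lambda>y. y) Y R"
  shows "forces P p (countable_fm b) \<rho>"
proof -
  define e :: "'v \<Rightarrow> 'v" where "e = vnat \<circ> to_nat_on Y"
  have "inj_on e Y"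
    unfolding e_def using inj_on_to_nat_on[OF assms(3)] by (auto simp: inj_on_def)
  moreover have "e ` Y \<subseteq> elts vomega"
    by (auto simp: e_def)
  ultimately show ?thesis
    unfolding countable_fm_def
    by (intro forces_ExistsI[of "restr_name (\<lambda>y. opair y (e y)) Y R"] forces_ExistsI[of "check P vomega"]
        is_name_check is_name_restr_name assms(2))
      (simp add: forces_omega_fm assms(1) forces_injection_fm[where C = vomega, OF assms(1,2)] assms(4))
qed

section \<open>Open sets and closures in the extension\<close>

lemma forces_open_fm_check:
  assumes "p \<in> conds P" "is_topological_space X \<tau>" "U \<in> elts \<tau>"
    and "\<rho> i = check P X" "\<rho> t = check P \<tau>" "\<rho> w = check P U"
  shows "forces P p (open_fm i t w) \<rho>"
proof -
  have "y \<in> elts X" if "y \<in> elts U" for y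
    using assms(2,3) that by (auto simp: is_topological_space_def)
  then have "forces P p (subset_fm w i) \<rho>"
    using assms by (simp add: forces_subset_fm_check[where x = U])
  moreover have "forces P p (BExists (t+1) (And (Mem 1 0) (subset_fm 0 (w+2)))) (case_nat (check P y) \<rho>)"
    if "y \<in> elts U" for y
    by (rule forces_BExistsI[of "check P U"])
      (use assms that in \<open>simp_all add: forces_subset_fm_check[where x = U]\<close>)
  ultimately show ?thesis
    by (simp add: open_fm_def forces_BForall_check[where \<rho> = \<rho>, OF assms(6,1)])
qed

text \<open>Closure can be tested on basic open sets, and these come from V: a name \<open>W\<close>
  for an open set around \<open>x\<close> includes, densely often, some \<open>U\<close> of
  \<open>\<tau>\<close> around \<open>x\<close>, and conversely each such \<open>U\<close> is itself
  open. What remains mentions only conditions, sets of V and forced membership of points of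
  V.\<close>

lemma forces_closure_fm:
  assumes p: "p \<in> conds P" and X: "is_topological_space X \<tau>" "x \<in> elts X"
    and \<rho>: "\<rho> i = check P X" "\<rho> t = check P \<tau>" "\<rho> j = check P x" and a: "is_name P (\<rho> a)"
  shows "forces P p (closure_fm i t a j) \<rho> \<longleftrightarrow>
    (\<forall>U\<in>elts \<tau>. x \<in> elts U \<longrightarrow>
      (\<forall>q. le P q p \<longrightarrow> (\<exists>r y. le P r q \<and> y \<in> elts U \<and> forces_mem P r (check P y) (\<rho> a))))"
    (is "?L \<longleftrightarrow> ?R")
proof
  assume L: ?L
  show ?R
  proof (intro ballI allI impI)
    fix U q assume U: "U \<in> elts \<tau>" "x \<in> elts U" and q: "le P q p"
    then have qc: "q \<in> conds P" using le_conds by blast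
    let ?\<sigma> = "case_nat (check P U) \<rho>"
    have "forces P q (open_fm (i+1) (t+1) 0) ?\<sigma>"
      by (rule forces_open_fm_check[OF qc X(1) U(1)]) (simp_all add: \<rho>)
    then have "forces P q (BExists (a+1) (Mem 0 1)) ?\<sigma>"
      using L q U qc \<rho>(3) by (simp add: closure_fm_def forces_Imp)
    then obtain r c s where r: "le P r q" "opair c s \<in> elts (\<rho> a)" "le P r s" "forces_mem P r c (check P U)"
      using le_refl[OF qc] a by (subst (asm) forces_BExists) auto
    then obtain r' y where r': "le P r' r" "y \<in> elts U" "forces_eq P r' c (check P y)"
      using le_refl le_conds by (metis forces_mem_checkE)
    then have "forces_mem P r' (check P y) (\<rho> a)"
      using forces_memI[OF r(2)] forces_eq_sym r(3) le_trans by blast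
    then show "\<exists>r y. le P r q \<and> y \<in> elts U \<and> forces_mem P r (check P y) (\<rho> a)"
      using r r' le_trans by blast
  qed
next
  assume R: ?R
  have "forces P q (BExists (a+1) (Mem 0 1)) (case_nat W \<rho>)"
    if W: "is_name P W" and q: "le P q p" and x: "forces_mem P q (check P x) W"
      and op: "forces P q (open_fm (i+1) (t+1) 0) (case_nat W \<rho>)" for W q
  proof (rule forces_dense)
    show "q \<in> conds P" using q le_conds by blast
    fix q' assume q': "le P q' q"
    let ?\<sigma> = "case_nat (check P x) (case_nat W \<rho>)"
    have "forces P q (BForall 0 (BExists (t+1+1) (And (Mem 1 0) (subset_fm 0 (0+2))))) (case_nat W \<rho>)"
      using op by (simp add: open_fm_def)
    then have "forces P q (BExists (t+1+1) (And (Mem 1 0) (subset_fm 0 (0+2)))) ?\<sigma>"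
      by (rule forces_BForallD) (use x in simp_all)
    then obtain r U where r: "le P r q'" "U \<in> elts \<tau>"
        "forces P r (And (Mem 1 0) (subset_fm 0 (0+2))) (case_nat (check P U) ?\<sigma>)"
      using q' \<rho>(2) by (subst (asm) forces_BExists_check[where x = \<tau>]) auto
    have rc: "r \<in> conds P" using r le_conds by blast
    have U: "x \<in> elts U" "\<And>y. y \<in> elts U \<Longrightarrow> forces_mem P r (check P y) W"
      using r(3) rc by (simp_all add: forces_subset_fm_check[where x = U] eval_nat_numeral)
    obtain r' y where r': "le P r' r" "y \<in> elts U" "forces_mem P r' (check P y) (\<rho> a)"
      using R r(1,2) U(1) q q' le_trans by meson
    moreover have "forces_mem P r' (check P y) W"
      using forces_mem_mono[OF U(2)[OF r'(2)] r'(1)] .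
    ultimately have "forces P r' (BExists (a+1) (Mem 0 1)) (case_nat W \<rho>)"
      by (intro forces_BExistsI[of "check P y"]) auto
    then show "\<exists>r. le P r q' \<and> forces P r (BExists (a+1) (Mem 0 1)) (case_nat W \<rho>)"
      using r r' le_trans by blast
  qed
  then show ?L
    using X(2) p \<rho> by (simp add: closure_fm_def forces_Imp)
qed

end

section \<open>Clubs and \<open>H(\<theta>)\<close>\<close>

text \<open>Unboundedness is closing off in omega steps: two arguments may appear at different
  stages, but the later stage contains both and the next one includes their value. The infinite size
  demanded by \<open>ctbl_subsets\<close> is inherited from \<open>z\<close>.\<close>

lemma club_closed:
  assumes a: "a \<in> H" and \<Phi>: "\<And>x y. countable (\<Phi> x y)" "\<And>x y. \<Phi> x y \<subseteq> H"
  shows "club H {M \<in> ctbl_subsets H. a \<in> M \<and> (\<forall>x\<in>M. \<forall>y\<in>M. \<Phi> x y \<subseteq> M)}"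
    (is "club H ?C")
  unfolding club_def
proof (intro conjI ballI allI impI)
  show "?C \<subseteq> ctbl_subsets H" by blast
next
  fix z assume z: "z \<in> ctbl_subsets H"
  define S where "S = rec_nat (insert a z) (\<lambda>_ M. M \<union> (\<Union>x\<in>M. \<Union>y\<in>M. \<Phi> x y))"
  have S_0: "S 0 = insert a z" and S_Suc: "S (Suc n) = S n \<union> (\<Union>x\<in>S n. \<Union>y\<in>S n. \<Phi> x y)" for n
    by (simp_all add: S_def)
  have S: "countable (S n) \<and> S n \<subseteq> H" for n
  proof (induction n)
    case 0
    then show ?case using z a by (auto simp: S_0 ctbl_subsets_def)
  next
    case (Suc n)
    then show ?case using \<Phi>(1) subsetD[OF \<Phi>(2)] unfolding S_Suc by (intro conjI countable_Un countable_UN) auto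
  qed
  have mono: "S m \<subseteq> S n" if "m \<le> n" for m n
    using that by (rule lift_Suc_mono_le[rotated]) (auto simp: S_Suc)
  have "\<Phi> x y \<subseteq> (\<Union>n. S n)" if xy: "x \<in> (\<Union>n. S n)" "y \<in> (\<Union>n. S n)" for x y
  proof -
    obtain m n where "x \<in> S m" "y \<in> S n" using xy by blast
    then have "x \<in> S (max m n)" "y \<in> S (max m n)"
      using mono[of m "max m n"] mono[of n "max m n"] by auto
    then have "\<Phi> x y \<subseteq> S (Suc (max m n))"
      unfolding S_Suc by blast
    then show ?thesis by blast
  qed
  moreover have sub: "insert a z \<subseteq> (\<Union>n. S n)"
    unfolding S_0[symmetric] by blast
  moreover have "(\<Union>n. S n) \<in> ctbl_subsets H"
    using S sub z infinite_super[of z "\<Union>n. S n"] by (auto simp: ctbl_subsets_def)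
  ultimately show "\<exists>y\<in>?C. z \<subseteq> y"
    by (intro bexI[of _ "\<Union>n. S n"]) auto
next
  fix x :: "nat \<Rightarrow> 'a set"
  assume "range x \<subseteq> ?C \<and> incseq x"
  then have x: "\<And>n. x n \<in> ?C" and inc: "incseq x" by auto
  have "\<Phi> u v \<subseteq> (\<Union>n. x n)" if uv: "u \<in> (\<Union>n. x n)" "v \<in> (\<Union>n. x n)" for u v
  proof -
    obtain m n where "u \<in> x m" "v \<in> x n" using uv by blast
    then have "u \<in> x (max m n)" "v \<in> x (max m n)"
      using incseqD[OF inc, of m "max m n"] incseqD[OF inc, of n "max m n"] by auto
    then show ?thesis
      using x[of "max m n"] by blast
  qed
  moreover have "(\<Union>n. x n) \<in> ctbl_subsets H"
  proof -
    have "x n \<subseteq> H" "countable (x n)" "infinite (x n)" for n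
      using x[of n] by (auto simp: ctbl_subsets_def)
    moreover from this have "infinite (\<Union>n. x n)"
      using infinite_super[of "x 0" "\<Union>n. x n"] by blast
    ultimately show ?thesis
      by (simp add: ctbl_subsets_def UN_least)
  qed
  moreover have "a \<in> (\<Union>n. x n)"
    using x by blast
  ultimately show "(\<Union>n. x n) \<in> ?C"
    by blast
qed

lemma Hset_elt:
  assumes "x \<in> Hset \<theta>" "y \<in> elts x"
  shows "y \<in> Hset \<theta>"
proof -
  have "trcl y \<subseteq> trcl x"
    using assms(2) by (auto simp: trcl_def intro: trancl.trancl_into_trancl)
  then show ?thesis
    using assms(1) ordLeq_ordLess_trans[OF card_of_mono1] by (auto simp: Hset_def)
qed

lemma Hset_opair_fst:
  assumes "opair a b \<in> Hset \<theta>"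
  shows "a \<in> Hset \<theta>"
  by (rule Hset_elt[OF Hset_elt[OF assms, of "vset {a}"]]) (simp_all add: opair_def)

lemma conds_subset_Hset:
  assumes "P \<in> Hset \<theta>"
  shows "conds P \<subseteq> Hset \<theta>"
  using assms by (auto simp: conds_def dest: Hset_opair_fst Hset_elt)

text \<open>In V the family \<open>\<tau>\<close> is a full topology, so \<open>closure_of\<close>
  tests exactly the elements of \<open>\<tau>\<close>. This gives tightness the same form as the
  forced closure statement.\<close>

lemma countably_tight_basic:
  assumes X: "is_topological_space X \<tau>" and tight: "countably_tight (topology_of \<tau>)"
    and "x \<in> elts X" "Z \<subseteq> elts X" "\<And>U. U \<in> elts \<tau> \<Longrightarrow> x \<in> elts U \<Longrightarrow> \<exists>z\<in>Z. z \<in> elts U"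
  obtains B where "B \<subseteq> Z" "countable B" "\<And>U. U \<in> elts \<tau> \<Longrightarrow> x \<in> elts U \<Longrightarrow> \<exists>z\<in>B. z \<in> elts U"
proof -
  have op: "openin (topology_of \<tau>) W \<longleftrightarrow> W \<in> elts ` elts \<tau>" for W
    using X by (simp add: topology_of_def is_topological_space_def)
  have top: "topspace (topology_of \<tau>) = elts X"
    using X by (auto simp: topspace_def op is_topological_space_def)
  have cl: "x \<in> topology_of \<tau> closure_of Z"
    using assms(3,5) by (auto simp: in_closure_of top op)
  then obtain B where "B \<subseteq> Z" "countable B" "x \<in> topology_of \<tau> closure_of B"
    using tight[unfolded countably_tight_def top, rule_format, OF assms(3,4) cl] by blast
  then show ?thesis
    by (intro that[of B]) (auto simp: in_closure_of op)
qed

section \<open>Preservation\<close>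

context forcing_poset
begin

text \<open>The combinatorial core, free of formulas: \<open>R y q\<close> stands for
  \<open>q\<close> forcing \<open>y\<close> into the name \<open>A\<close>, and only its
  monotonicity and density enter.\<close>

lemma dense_countable_trace:
  assumes X: "is_topological_space X \<tau>" "countably_tight (topology_of \<tau>)" "x \<in> elts X" "elts X \<subseteq> Hset \<theta>"
    and P: "conds P \<subseteq> Hset \<theta>"
    and stat: "stationary (Hset \<theta>) S" "\<And>M. M \<in> S \<Longrightarrow> strongly_proper_for P M"
    and q0: "q0 \<in> conds P"
    and mono: "\<And>y q r. R y q \<Longrightarrow> le P r q \<Longrightarrow> R y r"
    and dense: "\<And>U q. U \<in> elts \<tau> \<Longrightarrow> x \<in> elts U \<Longrightarrow> le P q q0 \<Longrightarrow>
      \<exists>r y. le P r q \<and> y \<in> elts U \<and> R y r"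
  obtains p Y where "le P p q0" "Y \<subseteq> elts X" "countable Y"
    "\<And>U q. U \<in> elts \<tau> \<Longrightarrow> x \<in> elts U \<Longrightarrow> le P q p \<Longrightarrow>
      \<exists>r y. le P r q \<and> y \<in> elts U \<inter> Y \<and> R y r"
proof -
  define Z where "Z r = {y \<in> elts X. \<exists>s. le P s r \<and> R y s}" for r
  have "\<exists>B. B \<subseteq> Z r \<and> countable B \<and> (\<forall>U\<in>elts \<tau>. x \<in> elts U \<longrightarrow> (\<exists>z\<in>B. z \<in> elts U))"
    if r: "le P r q0" for r
  proof -
    have "\<exists>z\<in>Z r. z \<in> elts U" if U: "U \<in> elts \<tau>" "x \<in> elts U" for U
    proof -
      obtain s y where "le P s r" "y \<in> elts U" "R y s"
        using dense[OF U r] by blast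
      moreover have "y \<in> elts X"
        using X(1) U(1) \<open>y \<in> elts U\<close> by (auto simp: is_topological_space_def)
      ultimately show ?thesis by (auto simp: Z_def)
    qed
    moreover have "Z r \<subseteq> elts X" by (auto simp: Z_def)
    ultimately show ?thesis
      using countably_tight_basic[OF X(1-3)] by metis
  qed
  then obtain B where B: "\<And>r. le P r q0 \<Longrightarrow>
      B r \<subseteq> Z r \<and> countable (B r) \<and> (\<forall>U\<in>elts \<tau>. x \<in> elts U \<longrightarrow> (\<exists>z\<in>B r. z \<in> elts U))"
    by metis
  define g where "g r y = (SOME s. le P s r \<and> R y s)" for r y
  define h where "h r = (SOME r'. le P r' r \<and> le P r' q0)" for r
  \<comment> \<open>\<open>SOME\<close> may return anything when no witness exists, and
    \<open>B r\<close> is controlled only below \<open>q0\<close>; the intersection and the case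
    distinction make every value a countable subset of \<open>Hset \<theta>\<close>. Genuine
    witnesses are conditions, so the intersection loses none of them.\<close>
  define \<Phi> where "\<Phi> r y = (if le P r q0 then B r else {}) \<union> {g r y, h r} \<inter> Hset \<theta>" for r y
  let ?C = "{M \<in> ctbl_subsets (Hset \<theta>). q0 \<in> M \<and> (\<forall>r\<in>M. \<forall>y\<in>M. \<Phi> r y \<subseteq> M)}"
  have "club (Hset \<theta>) ?C"
  proof (rule club_closed)
    show "q0 \<in> Hset \<theta>" using q0 P by blast
    show "countable (\<Phi> r y)" for r y
      using B by (auto simp: \<Phi>_def)
    show "\<Phi> r y \<subseteq> Hset \<theta>" for r y
      using B X(4) by (auto simp: \<Phi>_def Z_def)
  qed
  then obtain M where M: "M \<in> S" "M \<in> ?C"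
    using stat(1) unfolding stationary_def by blast
  obtain p where p: "le P p q0" "strongly_generic P M p"
    using stat(2)[OF M(1)] M(2) q0 unfolding strongly_proper_for_def by blast
  have "\<exists>t y. le P t q \<and> y \<in> elts U \<inter> (M \<inter> elts X) \<and> R y t"
    if U: "U \<in> elts \<tau>" "x \<in> elts U" and q: "le P q p" for U q
  proof -
    have "q \<in> conds P" using q le_conds by blast
    then obtain r where r: "r \<in> M" "r \<in> conds P"
        "\<And>s. s \<in> M \<Longrightarrow> le P s r \<Longrightarrow> compatible P s q"
      using p(2) q le_conds unfolding strongly_generic_def is_residue_def by blast
    \<comment> \<open>As an element of \<open>M\<close> below itself, \<open>r\<close> is compatible
      with \<open>q\<close>, which lies below \<open>q0\<close>; so \<open>h r\<close> is a genuine
      common extension. From here on \<open>h r\<close> replaces \<open>r\<close>.\<close>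
    have "\<exists>r'. le P r' r \<and> le P r' q0"
      using r(3)[OF r(1) le_refl[OF r(2)]] q p(1) le_trans unfolding compatible_def by blast
    then have h: "le P (h r) r" "le P (h r) q0"
      unfolding h_def by (metis (mono_tags, lifting) someI_ex)+
    then have "h r \<in> Hset \<theta>" using P le_conds by blast
    then have hM: "h r \<in> M"
      using M(2) r(1) by (auto simp: \<Phi>_def)
    obtain y where y: "y \<in> B (h r)" "y \<in> elts U"
      using B[OF h(2)] U by blast
    \<comment> \<open>The second argument is a dummy, since \<open>B\<close> depends on the
      condition alone; \<open>y\<close> is not yet known to be in \<open>M\<close>.\<close>
    have "\<Phi> (h r) (h r) \<subseteq> M"
      using M(2) hM by blast
    then have yM: "y \<in> M"
      using y(1) h(2) by (auto simp: \<Phi>_def)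
    have yZ: "y \<in> Z (h r)"
      using B[OF h(2)] y(1) by blast
    then have "\<exists>s. le P s (h r) \<and> R y s"
      by (simp add: Z_def)
    then have g: "le P (g (h r) y) (h r)" "R y (g (h r) y)"
      unfolding g_def by (metis (mono_tags, lifting) someI_ex)+
    then have "g (h r) y \<in> Hset \<theta>" using P le_conds by blast
    then have "g (h r) y \<in> M"
      using M(2) hM yM by (auto simp: \<Phi>_def)
    then have "compatible P (g (h r) y) q"
      using r(3) g(1) h(1) le_trans by blast
    then obtain t where t: "le P t (g (h r) y)" "le P t q"
      unfolding compatible_def by blast
    then show ?thesis
      using mono[OF g(2) t(1)] y(2) yM yZ by (auto simp: Z_def)
  qed
  moreover have "countable (M \<inter> elts X)"
    using M(2) by (auto simp: ctbl_subsets_def)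
  ultimately show ?thesis
    using that[OF p(1), of "M \<inter> elts X"] by blast
qed

lemma forces_countably_tight_fm:
  assumes X: "is_topological_space X \<tau>" "countably_tight (topology_of \<tau>)" "elts X \<subseteq> Hset \<theta>"
    and P: "conds P \<subseteq> Hset \<theta>"
    and stat: "stationary (Hset \<theta>) S" "\<And>M. M \<in> S \<Longrightarrow> strongly_proper_for P M"
    and p0: "p0 \<in> conds P"
    and \<rho>: "\<rho> 0 = check P X" "\<rho> 1 = check P \<tau>"
  shows "forces P p0 (countably_tight_fm 0 1) \<rho>"
proof -
  \<comment> \<open>Under the three quantifiers, indices 0, 1, 2 are the countable subset,
    \<open>A\<close> and \<open>x\<close>, while \<open>X\<close> and \<open>\<tau>\<close> have
    moved from 0 and 1 to 3 and 4.\<close>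
  let ?F = "Exists (And (subset_fm 0 1) (And (countable_fm 0) (closure_fm 3 4 0 2)))"
  have main: "forces P q0 ?F (case_nat A (case_nat (check P x) \<rho>))"
    if x: "x \<in> elts X" and A: "is_name P A" and q0: "le P q0 p0"
      and cl: "forces P q0 (closure_fm 2 3 0 1) (case_nat A (case_nat (check P x) \<rho>))" for x A q0
  proof (rule forces_dense)
    let ?\<rho> = "case_nat A (case_nat (check P x) \<rho>)"
    show q0c: "q0 \<in> conds P" using q0 le_conds by blast
    \<comment> \<open>Strong properness yields a suitable \<open>p\<close> only somewhere below a
      given condition, so the existential statement is established densely, starting from
      \<open>q1\<close>.\<close>
    fix q1 assume q1: "le P q1 q0"
    let ?R = "\<lambda>y q. forces_mem P q (check P y) A"
    have "\<forall>U\<in>elts \<tau>. x \<in> elts U \<longrightarrow> (\<forall>q. le P q q0 \<longrightarrow> (\<exists>r y. le P r q \<and> y \<in> elts U \<and> ?R y r))"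
      using cl \<rho> A by (subst (asm) forces_closure_fm[OF q0c X(1) x]) (auto simp: eval_nat_numeral)
    then have dense: "\<exists>r y. le P r q \<and> y \<in> elts U \<and> ?R y r"
      if "U \<in> elts \<tau>" "x \<in> elts U" "le P q q1" for U q
      using that q1 le_trans by blast
    have q1c: "q1 \<in> conds P" using q1 le_conds by blast
    obtain p Y where p: "le P p q1" and Y: "Y \<subseteq> elts X" "countable Y"
      and trace: "\<And>U q. U \<in> elts \<tau> \<Longrightarrow> x \<in> elts U \<Longrightarrow> le P q p \<Longrightarrow>
        \<exists>r y. le P r q \<and> y \<in> elts U \<inter> Y \<and> ?R y r"
      by (rule dense_countable_trace[where R = ?R, OF X(1,2) x X(3) P stat q1c forces_mem_mono dense])
        (assumption | rule that)+
    have pc: "p \<in> conds P" using p le_conds by blast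
    have small: "small Y" using small_subset[OF small_elts Y(1)] .
    \<comment> \<open>Each \<open>y\<close> in \<open>Y\<close> is attached to all conditions
      forcing it into \<open>A\<close>. Inclusion in \<open>A\<close> is then monotonicity, and
      every \<open>r\<close> found by \<open>trace\<close> is itself such a condition.\<close>
    let ?B = "restr_name (\<lambda>y. y) Y ?R"
    have name: "is_name P ?B" using small by (rule is_name_restr_name)
    have "forces P p (subset_fm 0 1) (case_nat ?B ?\<rho>)"
      using name small by (subst forces_subset_fm) (auto simp: opair_in_restr_name intro: forces_mem_mono)
    moreover have "forces P p (countable_fm 0) (case_nat ?B ?\<rho>)"
      by (rule forces_countable_fm[OF pc small Y(2)]) simp
    moreover have "forces P p (closure_fm 3 4 0 2) (case_nat ?B ?\<rho>)"
    proof (subst forces_closure_fm[OF pc X(1) x])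
      show "\<forall>U\<in>elts \<tau>. x \<in> elts U \<longrightarrow> (\<forall>q. le P q p \<longrightarrow>
          (\<exists>r y. le P r q \<and> y \<in> elts U \<and> forces_mem P r (check P y) (case_nat ?B ?\<rho> 0)))"
      proof (intro ballI allI impI)
        fix U q assume "U \<in> elts \<tau>" "x \<in> elts U" "le P q p"
        then obtain r y where r: "le P r q" "y \<in> elts U" "y \<in> Y" "?R y r"
          using trace by blast
        then have rc: "r \<in> conds P" using le_conds by blast
        then have "opair (check P y) r \<in> elts ?B"
          using r small by (auto simp: opair_in_restr_name)
        then have "forces_mem P r (check P y) ?B"
          using forces_memI le_refl forces_eq_refl rc by blast
        then show "\<exists>r y. le P r q \<and> y \<in> elts U \<and> forces_mem P r (check P y) (case_nat ?B ?\<rho> 0)"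
          using r by auto
      qed
    qed (use \<rho> name in \<open>simp_all add: eval_nat_numeral\<close>)
    ultimately have "forces P p ?F ?\<rho>"
      by (intro forces_ExistsI[OF name]) simp
    then show "\<exists>r. le P r q1 \<and> forces P r ?F ?\<rho>"
      using p by blast
  qed
  \<comment> \<open>Elements of the check name of \<open>X\<close> may be taken to be check names of
    points of V; \<open>A\<close> remains an arbitrary name.\<close>
  have "forces P p0 (Forall (Imp (And (subset_fm 0 2) (closure_fm 2 3 0 1)) ?F)) (case_nat (check P x) \<rho>)"
    if "x \<in> elts X" for x
    using main[OF that] by (simp add: forces_Imp)
  then show ?thesis
    by (simp add: countably_tight_fm_def forces_BForall_check[where \<rho> = \<rho>, OF \<rho>(1) p0] eval_nat_numeral)
qed

end

theorem theorem4p8: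
  fixes \<theta> X \<tau> P :: "'v::zfc"
  assumes "regular_cardinal \<theta>"
    and "large_enough \<theta> P X \<tau>"
    and "opair X \<tau> \<in> Hset \<theta>"
    and "is_topological_space X \<tau>"
    and "countably_tight (topology_of \<tau>)"
    and "P \<in> Hset \<theta>"
    and "is_poset P"
    and "stationary (Hset \<theta>)
           {M. countable M \<and> elementary_submodel M (Hset \<theta>) \<and> P \<in> M \<and> strongly_proper_for P M}"
  shows "forces_countably_tight P X \<tau>"
proof -
  interpret forcing_poset P
    by standard (rule assms(7))
  have "elts X \<subseteq> Hset \<theta>"
    using Hset_opair_fst[OF assms(3)] Hset_elt by blast
  then show ?thesis
    unfolding forces_countably_tight_def
    using forces_countably_tight_fm[OF assms(4,5) _ conds_subset_Hset[OF assms(6)] assms(8)] by simp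
qed

end
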